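(* The complexity measures $\mathsf{disc}$ and $\mathsf{D}^\times$ are incomparable, in the following sense (asymptotics as $n\to\infty$): 1. There is a family of functions $f_n\colon\{0,1\}^n\to\{0,1\}$ such that $\mathsf{disc}(f_n)=O(\log n)$ while $\mathsf{D}^\times(f_n)=\Theta(n)$. 2. There is a family of functions $f_n\colon\{0,1\}^n\to\{0,1\}$ such that $\mathsf{disc}(f_n)=\Theta(n)$ while $\mathsf{D}^\times(f_n)=O(1)$.
   Context: Inner products are over $\mathbb{F}_2$: $\langle a,x\rangle=\sum_i a_ix_i \bmod 2$. A deterministic parity decision tree $T$ on $\{0,1\}^n$ is a rooted binary tree in which every internal node is labelled by a vector $a\in\{0,1\}^n$ (the query $\langle a,x\rangle$) and has two children, one for each outcome in $\{0,1\}$, and every leaf is labelled by an output bit; $T(x)$ is the label of the leaf reached on input $x$. The depth of $T$ is the maximum number of queries on a root-to-leaf path. For $f\colon\{0,1\}^n\to\{0,1\}$ and a probability distribution $\mu$ on $\{0,1\}^n$, $\mathsf{D}_\epsilon(f,\mu)$ is the least depth of a deterministic parity decision tree $T$ with $\Pr_{x\sim\mu}[T(x)\ne f(x)]\le\epsilon$. A distribution on $\{0,1\}^n$ is product if it is a product of $n$ independent Bernoulli distributions. $\mathsf{D}^\times(f)=\max_{\mu\text{ product}}\mathsf{D}_{1/3}(f,\mu)$. For an affine subspace $S\subseteq\{0,1\}^n=\mathbb{F}_2^n$, let $\mathsf{bias}(f,\mu,S)=\left|\sum_{x\in S}(-1)^{f(x)}\mu(x)\right|$. Let $\mathsf{disc}(f,\mu)=-\log_2\max_{S}\mathsf{bias}(f,\mu,S)$,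 the maximum over all affine subspaces $S$ of $\{0,1\}^n$, and $\mathsf{disc}(f)=\max_\mu\mathsf{disc}(f,\mu)$ over all probability distributions $\mu$ on $\{0,1\}^n$. *)

theory Defs
  imports
    "HOL-Probability.Probability"
    "HOL-Library.Z2"
    "HOL-Library.Function_Algebras"
    "HOL-Library.Landau_Symbols"
begin

text \<open>
  A vector of \<open>F\<^sub>2\<^sup>n\<close> is a function \<open>nat \<Rightarrow> bit\<close> vanishing outside \<open>{..<n}\<close>, so that \<open>n\<close>
  can vary inside a statement. A Boolean function on the cube is a function
  \<open>(nat \<Rightarrow> bit) \<Rightarrow> bool\<close>; all measures below depend only on its values on \<open>cube n\<close>.
\<close>

definition cube :: "nat \<Rightarrow> (nat \<Rightarrow> bit) set" where
  "cube n = {x. \<forall>i\<ge>n. x i = 0}"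

definition scale_F2 :: "bit \<Rightarrow> (nat \<Rightarrow> bit) \<Rightarrow> nat \<Rightarrow> bit" where
  "scale_F2 c x = (\<lambda>i. c * x i)"

global_interpretation F2: vector_space scale_F2
  by unfold_locales (auto simp: scale_F2_def fun_eq_iff algebra_simps)

definition inner_F2 :: "nat \<Rightarrow> (nat \<Rightarrow> bit) \<Rightarrow> (nat \<Rightarrow> bit) \<Rightarrow> bit" where
  "inner_F2 n a x = (\<Sum>i<n. a i * x i)"

datatype pdt = Leaf bool | Query "nat \<Rightarrow> bit" pdt pdt

primrec pdt_on :: "nat \<Rightarrow> pdt \<Rightarrow> bool" where
  "pdt_on n (Leaf b) \<longleftrightarrow> True"
| "pdt_on n (Query a T0 T1) \<longleftrightarrow> a \<in> cube n \<and> pdt_on n T0 \<and> pdt_on n T1"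

primrec pdt_eval :: "nat \<Rightarrow> pdt \<Rightarrow> (nat \<Rightarrow> bit) \<Rightarrow> bool" where
  "pdt_eval n (Leaf b) x = b"
| "pdt_eval n (Query a T0 T1) x =
     (if inner_F2 n a x = 0 then pdt_eval n T0 x else pdt_eval n T1 x)"

primrec pdt_depth :: "pdt \<Rightarrow> nat" where
  "pdt_depth (Leaf b) = 0"
| "pdt_depth (Query a T0 T1) = Suc (max (pdt_depth T0) (pdt_depth T1))"

definition dists :: "nat \<Rightarrow> (nat \<Rightarrow> bit) pmf set" where
  "dists n = {\<mu>. set_pmf \<mu> \<subseteq> cube n}"

definition product_dists :: "nat \<Rightarrow> (nat \<Rightarrow> bit) pmf set" where
  "product_dists n =
     {Pi_pmf {..<n} 0 (\<lambda>i. map_pmf of_bool (bernoulli_pmf (p i))) | p. \<forall>i<n. p i \<in> {0..1}}"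

text \<open>
  A tree of depth at most \<open>n\<close> computing \<open>f\<close> on \<open>cube n\<close> exactly always exists, so for
  \<open>\<epsilon> \<ge> 0\<close> and \<open>\<mu> \<in> dists n\<close> the following \<open>LEAST\<close> is over a nonempty set and is at most \<open>n\<close>;
  hence the \<open>Max\<close> in the definition of \<open>D_prod\<close> is over a finite nonempty set.
\<close>

definition D_err :: "real \<Rightarrow> nat \<Rightarrow> ((nat \<Rightarrow> bit) \<Rightarrow> bool) \<Rightarrow> (nat \<Rightarrow> bit) pmf \<Rightarrow> nat" where
  "D_err \<epsilon> n f \<mu> =
     (LEAST d. \<exists>T. pdt_on n T \<and> pdt_depth T = d \<and>
                   measure_pmf.prob \<mu> {x. pdt_eval n T x \<noteq> f x} \<le> \<epsilon>)"

definition D_prod :: "nat \<Rightarrow> ((nat \<Rightarrow> bit) \<Rightarrow> bool) \<Rightarrow> nat" where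
  "D_prod n f = Max (D_err (1/3) n f ` product_dists n)"

definition affine_subspaces :: "nat \<Rightarrow> (nat \<Rightarrow> bit) set set" where
  "affine_subspaces n = {(+) a ` V | a V. a \<in> cube n \<and> V \<subseteq> cube n \<and> F2.subspace V}"

definition bias :: "((nat \<Rightarrow> bit) \<Rightarrow> bool) \<Rightarrow> (nat \<Rightarrow> bit) pmf \<Rightarrow> (nat \<Rightarrow> bit) set \<Rightarrow> real" where
  "bias f \<mu> S = \<bar>\<Sum>x\<in>S. (-1) ^ of_bool (f x) * pmf \<mu> x\<bar>"

definition disc_dist :: "nat \<Rightarrow> ((nat \<Rightarrow> bit) \<Rightarrow> bool) \<Rightarrow> (nat \<Rightarrow> bit) pmf \<Rightarrow> real" where
  "disc_dist n f \<mu> = - log 2 (MAX S\<in>affine_subspaces n. bias f \<mu> S)"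

text \<open>
  Some point has \<open>\<mu>\<close>-mass at least \<open>1/2^n\<close>, so \<open>disc_dist n f \<mu> \<le> n\<close> and the following supremum
  is over a nonempty set bounded above; by compactness of the simplex it is attained.
\<close>

definition disc :: "nat \<Rightarrow> ((nat \<Rightarrow> bit) \<Rightarrow> bool) \<Rightarrow> real" where
  "disc n f = (SUP \<mu>\<in>dists n. disc_dist n f \<mu>)"

end

theory Submission
  imports Defs "HOL-Real_Asymp.Real_Asymp"
begin

text \<open>
  First family: \<open>f\<close> is the indicator of the union of \<open>M = 2 ^ k\<close> random linear subspaces of
  codimension \<open>k = log n + O(1)\<close>. It is a threshold function of \<open>M\<close> subspace indicators, so its
  discrepancy is \<open>O(log M)\<close>. Under the uniform distribution about \<open>1/e > 1/3\<close> of the points are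
  missed by the union. On the other hand, on every affine subspace of codimension \<open>n/4\<close> all but
  \<open>2 n\<close> of the \<open>M\<close> subspaces remain pairwise independent, so by Bonferroni the union still covers
  almost half of it. Hence in a shallow tree the leaves labelled \<open>0\<close> are wrong almost half of
  the time, and the error cannot drop much below \<open>1/e\<close>.

  Second family: \<open>f\<close> is the inner product function placed on the threefold repetition code, and
  \<open>0\<close> off the code. The uniform distribution on the code gives linear discrepancy, because
  the sum of a nondegenerate quadratic character over an affine subspace is small. A product
  distribution, however, gives weight at most \<open>1/7\<close> to the code minus its heaviest codeword,
  so testing equality with that codeword by three random parities suffices.
\<close>

declare add_bit_eq_xor [simp del] mult_bit_eq_and [simp del]

subsection \<open>The cube and its characters\<close>

lemma bit_cases: "(b::bit) = 0 \<or> b = 1"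
  by (cases b) auto

lemma bit_add_self [simp]: "(b::bit) + b = 0"
  by (cases b) (auto simp: add_bit_eq_xor)

lemma F2_add_self [simp]: "(x::nat \<Rightarrow> bit) + x = 0"
  by (simp add: fun_eq_iff)

lemma F2_add_cancel [simp]: "(x::nat \<Rightarrow> bit) + (x + y) = y"
  by (simp flip: add.assoc)

lemma F2_eq_add_iff: "(x::nat \<Rightarrow> bit) = y + z \<longleftrightarrow> y + x = z"
  by (metis F2_add_cancel)

lemma zero_in_cube [simp]: "0 \<in> cube n"
  by (simp add: cube_def)

lemma add_in_cube: "x \<in> cube n \<Longrightarrow> y \<in> cube n \<Longrightarrow> x + y \<in> cube n"
  by (simp add: cube_def)

lemma cube_0 [simp]: "cube 0 = {0}"
  by (auto simp: cube_def fun_eq_iff)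

lemma cube_Suc: "cube (Suc n) = cube n \<union> (\<lambda>x. x(n := 1)) ` cube n"
proof -
  have "x \<in> cube n \<union> (\<lambda>x. x(n := 1)) ` cube n" if x: "x \<in> cube (Suc n)" for x
  proof (cases "x n")
    case zero
    have "x i = 0" if "i \<ge> n" for i
      using x that zero by (cases "i = n") (auto simp: cube_def)
    then show ?thesis by (simp add: cube_def)
  next
    case one
    then have "x = (x(n := 0))(n := 1)" by (auto simp: fun_eq_iff)
    moreover have "x(n := 0) \<in> cube n" using x by (auto simp: cube_def)
    ultimately show ?thesis by blast
  qed
  then show ?thesis by (auto simp: cube_def)
qed

lemma finite_cube [simp]: "finite (cube n)"
  by (induction n) (auto simp: cube_Suc)

lemma sum_cube_Suc:
  fixes g :: "(nat \<Rightarrow> bit) \<Rightarrow> 'a::comm_monoid_add"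
  shows "sum g (cube (Suc n)) = (\<Sum>x\<in>cube n. g x + g (x(n := 1)))"
proof -
  have "inj_on (\<lambda>x. x(n := 1)) (cube n)"
  proof (rule inj_onI)
    fix x y assume *: "x \<in> cube n" "y \<in> cube n" "x(n := 1) = y(n := 1)"
    show "x = y"
    proof
      fix i show "x i = y i"
        using * by (cases "i = n") (auto simp: cube_def fun_eq_iff, metis)
    qed
  qed
  moreover have "cube n \<inter> (\<lambda>x. x(n := 1)) ` cube n = {}"
    by (auto simp: cube_def)
  ultimately show ?thesis
    by (simp add: cube_Suc sum.union_disjoint sum.reindex sum.distrib)
qed

lemma sum_cube_prod:
  fixes w :: "nat \<Rightarrow> bit \<Rightarrow> 'a::comm_semiring_1"
  shows "(\<Sum>x\<in>cube n. \<Prod>i<n. w i (x i)) = (\<Prod>i<n. w i 0 + w i 1)"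
proof (induction n)
  case (Suc n)
  have "(\<Prod>i<Suc n. w i (x i)) + (\<Prod>i<Suc n. w i ((x(n := 1)) i)) = (\<Prod>i<n. w i (x i)) * (w n 0 + w n 1)"
    if "x \<in> cube n" for x
  proof -
    have "x n = 0" using that by (simp add: cube_def)
    moreover have "(\<Prod>i<n. w i (if i = n then 1 else x i)) = (\<Prod>i<n. w i (x i))"
      by (intro prod.cong) auto
    ultimately show ?thesis by (simp add: algebra_simps)
  qed
  then show ?case
    by (simp add: sum_cube_Suc Suc flip: sum_distrib_right)
qed simp

lemma card_cube: "card (cube n) = 2 ^ n"
  using sum_cube_prod[of "\<lambda>_ _. 1::nat" n] by (simp add: numeral_2_eq_2)

text \<open>The nontrivial additive character of the two-element field, real-valued so that signs
  can be averaged.\<close>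

definition chi :: "bit \<Rightarrow> real" where
  "chi b = (if b = 0 then 1 else -1)"

lemma chi_0 [simp]: "chi 0 = 1" and chi_1 [simp]: "chi 1 = -1"
  by (auto simp: chi_def)

lemma chi_add: "chi (a + b) = chi a * chi b"
  by (cases a; cases b) auto

lemma chi_mult_self [simp]: "chi a * chi a = 1"
  by (simp add: chi_def)

lemma inner_F2_add_left: "inner_F2 n (a + b) x = inner_F2 n a x + inner_F2 n b x"
  by (simp add: inner_F2_def distrib_right sum.distrib)

lemma inner_F2_add_right: "inner_F2 n a (x + y) = inner_F2 n a x + inner_F2 n a y"
  by (simp add: inner_F2_def distrib_left sum.distrib)

lemma inner_F2_0_left [simp]: "inner_F2 n 0 x = 0"
  by (simp add: inner_F2_def)

lemma inner_F2_0_right [simp]: "inner_F2 n x 0 = 0"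
  by (simp add: inner_F2_def)

lemma inner_F2_commute: "inner_F2 n a x = inner_F2 n x a"
  by (simp add: inner_F2_def mult.commute)

definition unit_F2 :: "nat \<Rightarrow> nat \<Rightarrow> bit" where
  "unit_F2 i = (\<lambda>j. of_bool (j = i))"

lemma unit_F2_in_cube [simp]: "i < n \<Longrightarrow> unit_F2 i \<in> cube n"
  by (auto simp: cube_def unit_F2_def)

lemma inner_unit_F2: "i < n \<Longrightarrow> inner_F2 n (unit_F2 i) x = x i"
proof -
  assume "i < n"
  have "inner_F2 n (unit_F2 i) x = (\<Sum>j<n. if j = i then x j else 0)"
    unfolding inner_F2_def unit_F2_def by (intro sum.cong) auto
  then show ?thesis using \<open>i < n\<close> by simp
qed

lemma cube_neq_0E:
  assumes "u \<in> cube n" "u \<noteq> 0"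
  obtains i where "i < n" "u i = 1"
proof -
  obtain i where "u i \<noteq> 0" using assms(2) by (auto simp: fun_eq_iff)
  then show ?thesis using that[of i] assms(1) bit_cases[of "u i"]
    by (force simp: cube_def not_le[symmetric])
qed

lemma sum_shift_group:
  fixes g :: "(nat \<Rightarrow> bit) \<Rightarrow> 'a::comm_monoid_add"
  assumes "\<And>x y. x \<in> V \<Longrightarrow> y \<in> V \<Longrightarrow> x + y \<in> V" "v \<in> V"
  shows "(\<Sum>x\<in>V. g (v + x)) = (\<Sum>x\<in>V. g x)"
  by (rule sum.reindex_bij_witness[of _ "\<lambda>x. v + x" "\<lambda>x. v + x"]) (use assms in auto)

text \<open>Translation by \<open>v\<close> permutes \<open>V\<close> and negates every summand, so
  the sum equals its own negative.\<close>

lemma sum_character_eq_0: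
  fixes V :: "(nat \<Rightarrow> bit) set"
  assumes "\<And>x y. x \<in> V \<Longrightarrow> y \<in> V \<Longrightarrow> x + y \<in> V" "v \<in> V"
    and "\<And>x. x \<in> V \<Longrightarrow> h (v + x) = - h x"
  shows "(\<Sum>x\<in>V. h x) = (0::real)"
  using sum_shift_group[of V v h] assms by (simp add: sum_negf)

text \<open>Orthogonality: \<open>u\<close> has a coordinate equal to \<open>1\<close>, and flipping
  that coordinate of \<open>x\<close> flips the sign.\<close>

lemma sum_chi_cube:
  assumes "u \<in> cube n" "u \<noteq> 0"
  shows "(\<Sum>x\<in>cube n. chi (inner_F2 n u x)) = 0"
proof -
  obtain i where "i < n" "u i = 1" using assms by (rule cube_neq_0E)
  then show ?thesis
    by (intro sum_character_eq_0[of _ "unit_F2 i"])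
      (auto simp: add_in_cube inner_F2_add_right chi_add inner_F2_commute[of n u "unit_F2 i"] inner_unit_F2)
qed

subsection \<open>Parity decision trees\<close>

text \<open>Induction on the number \<open>r\<close> of unread coordinates: \<open>z\<close> records
  the first \<open>n - r\<close> answers, and the next query reads one more coordinate. At
  \<open>r = n\<close> nothing is fixed, so one tree computes \<open>f\<close> on the whole
  cube.\<close>

lemma pdt_exact:
  assumes "r \<le> n" "z \<in> cube n"
  shows "\<exists>T. pdt_on n T \<and> pdt_depth T \<le> r \<and>
    (\<forall>x\<in>cube n. (\<forall>i<n - r. x i = z i) \<longrightarrow> pdt_eval n T x = f x)"
  using assms
proof (induction r arbitrary: z)
  case 0
  have "x = z" if "x \<in> cube n" "\<forall>i<n. x i = z i" for x
    using that 0 by (auto simp: fun_eq_iff cube_def not_less) (metis not_less)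
  then show ?case by (intro exI[of _ "Leaf (f z)"]) auto
next
  case (Suc r)
  let ?i = "n - Suc r"
  have i: "?i < n" "n - r = Suc ?i" using Suc.prems by auto
  have z: "z(?i := b) \<in> cube n" for b using Suc.prems i by (auto simp: cube_def)
  have "\<forall>b. \<exists>T. pdt_on n T \<and> pdt_depth T \<le> r \<and>
    (\<forall>x\<in>cube n. (\<forall>j<n - r. x j = (z(?i := b)) j) \<longrightarrow> pdt_eval n T x = f x)"
    using Suc.IH[OF _ z] Suc.prems by simp
  then obtain T where T: "\<And>b. pdt_on n (T b)" "\<And>b. pdt_depth (T b) \<le> r"
    "\<And>b x. x \<in> cube n \<Longrightarrow> (\<forall>j<n - r. x j = (z(?i := b)) j) \<Longrightarrow> pdt_eval n (T b) x = f x"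
    by metis
  have "pdt_eval n (Query (unit_F2 ?i) (T 0) (T 1)) x = f x"
    if x: "x \<in> cube n" "\<forall>j<?i. x j = z j" for x
  proof -
    have "pdt_eval n (T (x ?i)) x = f x"
      using x i by (intro T(3)) (auto simp: less_Suc_eq)
    then show ?thesis using bit_cases[of "x ?i"] by (auto simp: inner_unit_F2[OF i(1)])
  qed
  then show ?case using T i
    by (intro exI[of _ "Query (unit_F2 ?i) (T 0) (T 1)"]) auto
qed

section \<open>Product distributions and elementary bounds on \<open>D_err\<close> and
  \<open>D_prod\<close>\<close>

lemma product_dists_subset: "product_dists n \<subseteq> dists n"
proof -
  have "set_pmf (Pi_pmf {..<n} 0 q) \<subseteq> cube n" for q :: "nat \<Rightarrow> bit pmf"
    using set_Pi_pmf_subset[of "{..<n}" 0 q] by (auto simp: cube_def not_less)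
  then show ?thesis by (auto simp: product_dists_def dists_def)
qed

lemma prob_eq_sum_cube:
  assumes "\<mu> \<in> dists n"
  shows "measure_pmf.prob \<mu> E = (\<Sum>x\<in>E \<inter> cube n. pmf \<mu> x)"
proof -
  have "measure_pmf.prob \<mu> E = measure_pmf.prob \<mu> (E \<inter> cube n)"
    using assms by (intro measure_pmf.finite_measure_eq_AE) (auto simp: dists_def AE_measure_pmf_iff)
  then show ?thesis by (simp add: measure_measure_pmf_finite)
qed

lemma sum_pmf_cube: "\<mu> \<in> dists n \<Longrightarrow> (\<Sum>x\<in>cube n. pmf \<mu> x) = 1"
  by (rule sum_pmf_eq_1) (auto simp: dists_def)

lemma D_err_le:
  assumes "pdt_on n T" "pdt_depth T \<le> d" "measure_pmf.prob \<mu> {x. pdt_eval n T x \<noteq> f x} \<le> \<epsilon>"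
  shows "D_err \<epsilon> n f \<mu> \<le> d"
proof -
  have "D_err \<epsilon> n f \<mu> \<le> pdt_depth T"
    unfolding D_err_def by (rule Least_le) (use assms in blast)
  then show ?thesis using assms by simp
qed

lemma ex_pdt_exact:
  assumes "\<mu> \<in> dists n"
  obtains T where "pdt_on n T" "pdt_depth T \<le> n" "measure_pmf.prob \<mu> {x. pdt_eval n T x \<noteq> f x} = 0"
proof -
  obtain T where T: "pdt_on n T" "pdt_depth T \<le> n" "\<forall>x\<in>cube n. pdt_eval n T x = f x"
    using pdt_exact[of n n 0 f] by auto
  then have "{x. pdt_eval n T x \<noteq> f x} \<inter> cube n = {}" by auto
  then show ?thesis using that[OF T(1,2)] by (simp add: prob_eq_sum_cube[OF assms])
qed

lemma D_err_le_n: "\<mu> \<in> dists n \<Longrightarrow> D_err (1/3) n f \<mu> \<le> n"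
  by (rule ex_pdt_exact[of \<mu> n f]) (auto intro!: D_err_le)

text \<open>An exact tree exists, so the \<open>LEAST\<close> is attained by a tree of error at most
  \<open>1/3\<close>; the hypothesis forces its depth above \<open>d\<close>.\<close>

lemma less_D_err:
  assumes "\<mu> \<in> dists n"
    and "\<And>T. pdt_on n T \<Longrightarrow> pdt_depth T \<le> d \<Longrightarrow> measure_pmf.prob \<mu> {x. pdt_eval n T x \<noteq> f x} > 1/3"
  shows "d < D_err (1/3) n f \<mu>"
proof -
  obtain T where "pdt_on n T" "measure_pmf.prob \<mu> {x. pdt_eval n T x \<noteq> f x} = 0"
    using assms(1) by (rule ex_pdt_exact[of \<mu> n f])
  then have "\<exists>d T. pdt_on n T \<and> pdt_depth T = d \<and> measure_pmf.prob \<mu> {x. pdt_eval n T x \<noteq> f x} \<le> 1/3"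
    by (intro exI[of _ "pdt_depth T"] exI[of _ T]) simp
  then have "\<exists>T. pdt_on n T \<and> pdt_depth T = D_err (1/3) n f \<mu> \<and>
      measure_pmf.prob \<mu> {x. pdt_eval n T x \<noteq> f x} \<le> 1/3"
    unfolding D_err_def by (rule LeastI_ex)
  then obtain T where "pdt_on n T" "pdt_depth T = D_err (1/3) n f \<mu>"
    "measure_pmf.prob \<mu> {x. pdt_eval n T x \<noteq> f x} \<le> 1/3" by blast
  with assms(2)[of T] show ?thesis by linarith
qed

lemma finite_D_err_image: "finite (D_err (1/3) n f ` product_dists n)"
proof (rule finite_subset)
  show "D_err (1/3) n f ` product_dists n \<subseteq> {..n}"
    using D_err_le_n product_dists_subset by blast
qed simp

lemma product_dists_nonempty: "product_dists n \<noteq> {}"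
proof -
  have "Pi_pmf {..<n} 0 (\<lambda>i. map_pmf of_bool (bernoulli_pmf ((\<lambda>_. 0) i))) \<in> product_dists n"
    unfolding product_dists_def by (rule CollectI, rule exI[of _ "\<lambda>_. 0"]) simp
  then show ?thesis by (metis empty_iff)
qed

lemma D_err_le_D_prod: "\<mu> \<in> product_dists n \<Longrightarrow> D_err (1/3) n f \<mu> \<le> D_prod n f"
  unfolding D_prod_def by (rule Max_ge[OF finite_D_err_image]) auto

lemma D_prod_le: "(\<And>\<mu>. \<mu> \<in> product_dists n \<Longrightarrow> D_err (1/3) n f \<mu> \<le> d) \<Longrightarrow> D_prod n f \<le> d"
  unfolding D_prod_def
  by (rule Max.boundedI[OF finite_D_err_image]) (use product_dists_nonempty in auto)

lemma D_prod_le_n: "D_prod n f \<le> n"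
  by (rule D_prod_le) (use D_err_le_n product_dists_subset in blast)

subsection \<open>Discrepancy\<close>

lemma finite_affine_subspaces [simp]: "finite (affine_subspaces n)"
  by (rule finite_subset[of _ "Pow (cube n)"]) (auto simp: affine_subspaces_def intro: add_in_cube)

lemma subspace_F2_iff: "F2.subspace V \<longleftrightarrow> 0 \<in> V \<and> (\<forall>x\<in>V. \<forall>y\<in>V. x + y \<in> V)"
proof -
  have "scale_F2 c x \<in> V" if "0 \<in> V" "x \<in> V" for c x
    using bit_cases[of c] that by (auto simp: scale_F2_def zero_fun_def)
  then show ?thesis unfolding F2.subspace_def by blast
qed

lemma subspace_in_affine_subspaces:
  assumes "V \<subseteq> cube n" "F2.subspace V"
  shows "V \<in> affine_subspaces n"
proof -
  have "V = (+) 0 ` V" by simp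
  then show ?thesis using assms zero_in_cube[of n] unfolding affine_subspaces_def by blast
qed

lemma cube_in_affine_subspaces: "cube n \<in> affine_subspaces n"
  by (rule subspace_in_affine_subspaces) (auto simp: subspace_F2_iff add_in_cube)

lemma singleton_in_affine_subspaces: "x \<in> cube n \<Longrightarrow> {x} \<in> affine_subspaces n"
  unfolding affine_subspaces_def
  by (intro CollectI exI[of _ x] exI[of _ "{0}"]) (auto simp: subspace_F2_iff)

lemma pmf_le_Max_bias:
  assumes "x \<in> cube n"
  shows "pmf \<mu> x \<le> (MAX S\<in>affine_subspaces n. bias f \<mu> S)"
proof -
  have "bias f \<mu> {x} = pmf \<mu> x" by (simp add: bias_def abs_mult power_abs)
  moreover have "bias f \<mu> {x} \<le> (MAX S\<in>affine_subspaces n. bias f \<mu> S)"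
    by (rule Max_ge) (use singleton_in_affine_subspaces[OF assms] in auto)
  ultimately show ?thesis by simp
qed

text \<open>Singletons are affine subspaces, so the maximal bias dominates every point mass, and
  these average \<open>1 / 2 ^ n\<close> over the cube. In particular the logarithm is taken of a
  positive number.\<close>

lemma Max_bias_ge:
  assumes "\<mu> \<in> dists n"
  shows "1 / 2 ^ n \<le> (MAX S\<in>affine_subspaces n. bias f \<mu> S)"
proof (rule ccontr)
  assume "\<not> ?thesis"
  moreover have "cube n \<noteq> {}" using zero_in_cube[of n] by blast
  ultimately have "(\<Sum>x\<in>cube n. pmf \<mu> x) < (\<Sum>x\<in>cube n. 1 / 2 ^ n)"
    using pmf_le_Max_bias[of _ n \<mu> f]
    by (intro sum_strict_mono) (auto simp: not_le intro: le_less_trans)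
  then show False by (simp add: sum_pmf_cube[OF assms] card_cube)
qed

lemma Max_bias_pos: "\<mu> \<in> dists n \<Longrightarrow> 0 < (MAX S\<in>affine_subspaces n. bias f \<mu> S)"
  by (rule less_le_trans[OF _ Max_bias_ge]) auto

lemma disc_dist_le_n:
  assumes "\<mu> \<in> dists n"
  shows "disc_dist n f \<mu> \<le> n"
proof -
  have "log 2 (1 / 2 ^ n) \<le> log 2 (MAX S\<in>affine_subspaces n. bias f \<mu> S)"
    using Max_bias_ge[OF assms, of f] Max_bias_pos[OF assms, of f] by (subst log_le_cancel_iff) auto
  then show ?thesis by (simp add: disc_dist_def log_divide log_nat_power)
qed

lemma dists_nonempty: "dists n \<noteq> {}"
  using product_dists_nonempty product_dists_subset by blast

lemma disc_le: "(\<And>\<mu>. \<mu> \<in> dists n \<Longrightarrow> disc_dist n f \<mu> \<le> c) \<Longrightarrow> disc n f \<le> c"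
  unfolding disc_def by (rule cSUP_least[OF dists_nonempty])

lemma disc_le_n: "disc n f \<le> n"
  by (rule disc_le[OF disc_dist_le_n])

lemma disc_dist_le_disc: "\<mu> \<in> dists n \<Longrightarrow> disc_dist n f \<mu> \<le> disc n f"
  unfolding disc_def by (rule cSUP_upper) (auto intro!: bdd_aboveI[of _ n] disc_dist_le_n)

lemma disc_dist_geI:
  assumes "\<mu> \<in> dists n" "\<And>S. S \<in> affine_subspaces n \<Longrightarrow> bias f \<mu> S \<le> 2 powr - c"
  shows "c \<le> disc_dist n f \<mu>"
proof -
  let ?M = "MAX S\<in>affine_subspaces n. bias f \<mu> S"
  have "?M > 0" by (rule Max_bias_pos[OF assms(1)])
  moreover have "?M \<le> 2 powr - c"
    by (rule Max.boundedI) (use cube_in_affine_subspaces[of n] assms(2) in auto)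
  ultimately have "log 2 ?M \<le> log 2 (2 powr - c)" by (subst log_le_cancel_iff) auto
  then show ?thesis by (simp add: disc_dist_def)
qed

lemma bias_le_1:
  assumes "\<mu> \<in> dists n" "S \<subseteq> cube n"
  shows "bias f \<mu> S \<le> 1"
proof -
  have "bias f \<mu> S \<le> (\<Sum>x\<in>S. \<bar>(-1) ^ of_bool (f x) * pmf \<mu> x\<bar>)"
    unfolding bias_def by (rule sum_abs)
  also have "\<dots> = (\<Sum>x\<in>S. pmf \<mu> x)" by (simp add: abs_mult power_abs)
  also have "\<dots> \<le> (\<Sum>x\<in>cube n. pmf \<mu> x)" using assms(2) by (intro sum_mono2) auto
  finally show ?thesis by (simp add: sum_pmf_cube[OF assms(1)])
qed

lemma affine_subspace_subset: "S \<in> affine_subspaces n \<Longrightarrow> S \<subseteq> cube n"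
  by (auto simp: affine_subspaces_def intro: add_in_cube)

text \<open>No bias exceeds \<open>1\<close>. The Landau bounds speak of absolute values, which this
  sign removes.\<close>

lemma disc_nonneg: "0 \<le> disc n f"
proof -
  obtain \<mu> where \<mu>: "\<mu> \<in> dists n" using dists_nonempty by blast
  have "0 \<le> disc_dist n f \<mu>"
    by (rule disc_dist_geI[OF \<mu>]) (simp add: bias_le_1[OF \<mu> affine_subspace_subset])
  then show ?thesis using disc_dist_le_disc[OF \<mu>, of f] by simp
qed

subsection \<open>Inner product on a repetition code: large discrepancy\<close>

definition rep3 :: "(nat \<Rightarrow> bit) \<Rightarrow> nat \<Rightarrow> bit" where
  "rep3 y = (\<lambda>i. y (i div 3))"

lemma rep3_add: "rep3 (x + y) = rep3 x + rep3 y"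
  by (simp add: rep3_def fun_eq_iff)

lemma rep3_0 [simp]: "rep3 0 = 0"
  by (simp add: rep3_def fun_eq_iff)

lemma rep3_inject [simp]: "rep3 x = rep3 y \<longleftrightarrow> x = y"
proof
  assume *: "rep3 x = rep3 y"
  show "x = y"
  proof
    fix i show "x i = y i" using fun_cong[OF *, of "3 * i"] by (simp add: rep3_def)
  qed
qed simp

lemma rep3_in_cube: "y \<in> cube m \<Longrightarrow> 3 * m \<le> n \<Longrightarrow> rep3 y \<in> cube n"
  by (auto simp: rep3_def cube_def)

definition ip :: "nat \<Rightarrow> (nat \<Rightarrow> bit) \<Rightarrow> bit" where
  "ip h y = (\<Sum>i<h. y (2 * i) * y (2 * i + 1))"

text \<open>The Gram matrix of the polar form of \<open>ip\<close>:
  \<open>inner_F2 (2 * h) x (swap_pairs v)\<close> is the symplectic form measuring how far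
  \<open>ip\<close> is from additive.\<close>

definition swap_pairs :: "(nat \<Rightarrow> bit) \<Rightarrow> nat \<Rightarrow> bit" where
  "swap_pairs v = (\<lambda>i. if even i then v (i + 1) else v (i - 1))"

lemma swap_pairs_in_cube: "v \<in> cube (2 * h) \<Longrightarrow> swap_pairs v \<in> cube (2 * h)"
  by (auto simp: cube_def swap_pairs_def elim!: oddE)

text \<open>Injectivity of the Gram matrix, which makes the symplectic form nondegenerate.\<close>

lemma swap_pairs_eq_0_iff: "swap_pairs v = 0 \<longleftrightarrow> v = 0"
proof
  assume *: "swap_pairs v = 0"
  show "v = 0"
  proof
    fix i show "v i = 0 i"
      using fun_cong[OF *, of "if even i then i + 1 else i - 1"]
      by (auto simp: swap_pairs_def split: if_splits elim!: oddE)
  qed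
qed (simp add: swap_pairs_def fun_eq_iff)

lemma swap_pairs_0: "swap_pairs 0 = 0"
  by (simp add: swap_pairs_eq_0_iff)

lemma inner_swap_pairs:
  "inner_F2 (2 * h) x (swap_pairs v) = (\<Sum>i<h. x (2 * i) * v (2 * i + 1) + x (2 * i + 1) * v (2 * i))"
proof (induction h)
  case (Suc h)
  have "{..<2 * Suc h} = insert (2 * h + 1) (insert (2 * h) {..<2 * h})" by auto
  then show ?case using Suc by (simp add: inner_F2_def swap_pairs_def algebra_simps)
qed (simp add: inner_F2_def)

lemma inner_swap_pairs_commute: "inner_F2 (2 * h) x (swap_pairs v) = inner_F2 (2 * h) (swap_pairs x) v"
  unfolding inner_F2_commute[of _ "swap_pairs x"] inner_swap_pairs
  by (intro sum.cong) (auto simp: algebra_simps)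

lemma ip_add: "ip h (x + v) = ip h x + ip h v + inner_F2 (2 * h) x (swap_pairs v)"
  unfolding ip_def inner_swap_pairs by (simp add: sum.distrib algebra_simps)

text \<open>The sum is squared. By polarisation \<open>F x * F (v + x)\<close> is a sign depending
  on \<open>v\<close> times a character of \<open>x\<close>, so the square is at most the sum over
  \<open>v\<close> of the character sums \<open>G v\<close>. Letting \<open>v\<close> range over the
  whole cube, nondegeneracy leaves only \<open>x = 0\<close>, worth
  \<open>2 ^ (2 * h)\<close>.\<close>

lemma sum_chi_ip_subspace:
  assumes V: "V \<subseteq> cube (2 * h)" "0 \<in> V" "\<And>x y. x \<in> V \<Longrightarrow> y \<in> V \<Longrightarrow> x + y \<in> V"
  shows "\<bar>\<Sum>x\<in>V. chi (ip h (a + x))\<bar> \<le> 2 ^ h"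
proof -
  let ?B = "\<lambda>x v. inner_F2 (2 * h) x (swap_pairs v)"
  define F where "F = (\<lambda>x. chi (ip h (a + x)))"
  define G where "G = (\<lambda>v. \<Sum>x\<in>V. chi (?B x v))"
  have finV: "finite V" using finite_subset[OF V(1)] by simp
  have FF: "F x * F (v + x) = chi (ip h v + ?B a v) * chi (?B x v)" for x v
  proof -
    have "a + (v + x) = (a + x) + v" by (simp add: add_ac)
    then have "F (v + x) = F x * (chi (ip h v) * chi (?B (a + x) v))"
      by (simp only: F_def ip_add[of h "a + x" v] chi_add mult.assoc)
    moreover have "F x * F x = 1" by (simp add: F_def)
    ultimately show ?thesis
      by (simp add: chi_add inner_F2_add_left flip: mult.assoc)
  qed
  \<comment> \<open>\<open>G v\<close> sums a character over the group \<open>V\<close>: either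
    every term is \<open>1\<close>, or the sum vanishes.\<close>
  have G_nonneg: "0 \<le> G v" for v
  proof (cases "\<forall>x\<in>V. ?B x v = 0")
    case False
    then obtain w where w: "w \<in> V" "?B w v = 1" using bit_cases by blast
    have "G v = 0" unfolding G_def
      by (rule sum_character_eq_0[of V w]) (use V w in \<open>auto simp: inner_F2_add_left chi_add\<close>)
    then show ?thesis by simp
  qed (simp add: G_def)
  have "(\<Sum>x\<in>V. F x)\<^sup>2 = (\<Sum>x\<in>V. F x * (\<Sum>v\<in>V. F (v + x)))"
  proof -
    have "(\<Sum>v\<in>V. F (v + x)) = (\<Sum>v\<in>V. F v)" if "x \<in> V" for x
      using sum_shift_group[of V x F] V(3) that by (simp add: add.commute)
    then show ?thesis by (simp add: power2_eq_square sum_distrib_right)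
  qed
  also have "\<dots> = (\<Sum>x\<in>V. \<Sum>v\<in>V. chi (ip h v + ?B a v) * chi (?B x v))"
    by (simp add: sum_distrib_left FF)
  also have "\<dots> = (\<Sum>v\<in>V. chi (ip h v + ?B a v) * G v)"
    by (subst sum.swap) (simp add: G_def sum_distrib_left)
  also have "\<dots> \<le> (\<Sum>v\<in>V. G v)"
  proof (rule sum_mono)
    fix v
    have "chi b * G v \<le> 1 * G v" for b
      by (rule mult_right_mono[OF _ G_nonneg]) (simp add: chi_def)
    then show "chi (ip h v + ?B a v) * G v \<le> G v" by simp
  qed
  \<comment> \<open>Since every \<open>G v\<close> is nonnegative, enlarging the range of
    \<open>v\<close> only increases the sum, and orthogonality in \<open>v\<close> becomes
    available.\<close>
  also have "\<dots> \<le> (\<Sum>v\<in>cube (2 * h). G v)"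
    using V(1) G_nonneg by (intro sum_mono2) auto
  also have "\<dots> = (\<Sum>x\<in>V. \<Sum>v\<in>cube (2 * h). chi (?B x v))"
    unfolding G_def by (rule sum.swap)
  also have "\<dots> = (\<Sum>x\<in>V. if x = 0 then 2 ^ (2 * h) else 0)"
  proof (rule sum.cong)
    fix x assume "x \<in> V"
    then have "x \<in> cube (2 * h)" using V(1) by auto
    then show "(\<Sum>v\<in>cube (2 * h). chi (?B x v)) = (if x = 0 then 2 ^ (2 * h) else 0)"
      using sum_chi_cube[of "swap_pairs x" "2 * h"]
      by (auto simp: card_cube inner_swap_pairs_commute swap_pairs_in_cube swap_pairs_eq_0_iff[of x] swap_pairs_0)
  qed simp
  also have "\<dots> = (2 ^ h)\<^sup>2"
    using V(2) finV by (simp add: power_mult[of 2 2 h] power_mult mult.commute[of 2 h])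
  finally show ?thesis
    unfolding F_def by (simp add: abs_le_square_iff[of _ "2 ^ h", simplified])
qed

definition ip_code :: "nat \<Rightarrow> (nat \<Rightarrow> bit) \<Rightarrow> bool" where
  "ip_code h x \<longleftrightarrow> (\<exists>y\<in>cube (2 * h). x = rep3 y \<and> ip h y = 1)"

lemma ip_code_rep3: "y \<in> cube (2 * h) \<Longrightarrow> (-1) ^ of_bool (ip_code h (rep3 y)) = chi (ip h y)"
  using bit_cases[of "ip h y"] by (auto simp: ip_code_def chi_def)

text \<open>For the uniform distribution on the code, the bias of an affine subspace is a quadratic
  character sum over a coset, at most \<open>2 ^ h\<close>, divided by the code size
  \<open>2 ^ (2 * h)\<close>.\<close>

lemma disc_ip_code:
  assumes "6 * h \<le> n"
  shows "h \<le> disc n (ip_code h)"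
proof -
  let ?Y = "cube (2 * h)"
  define \<mu> where "\<mu> = map_pmf rep3 (pmf_of_set ?Y)"
  have Y: "?Y \<noteq> {}" using zero_in_cube by blast
  have set: "set_pmf \<mu> = rep3 ` ?Y" by (simp add: \<mu>_def Y)
  have inj: "inj rep3" by (rule injI) simp
  have pmf: "pmf \<mu> (rep3 y) = 1 / 2 ^ (2 * h)" if "y \<in> ?Y" for y
    using that Y by (simp add: \<mu>_def pmf_map_inj' inj card_cube)
  have \<mu>: "\<mu> \<in> dists n"
    using assms by (auto simp: dists_def set intro!: rep3_in_cube)
  have "bias (ip_code h) \<mu> S \<le> 2 powr - real h" if S: "S \<in> affine_subspaces n" for S
  proof -
    define S' where "S' = {y\<in>?Y. rep3 y \<in> S}"
    from S obtain a V where V: "S = (+) a ` V" "V \<subseteq> cube n" "0 \<in> V" "\<And>x y. x \<in> V \<Longrightarrow> y \<in> V \<Longrightarrow> x + y \<in> V"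
      by (auto simp: affine_subspaces_def subspace_F2_iff)
    have S_iff: "x \<in> S \<longleftrightarrow> a + x \<in> V" for x
      unfolding V(1) using F2_eq_add_iff by auto
    have "finite S" using affine_subspace_subset[OF S] by (rule finite_subset) simp
    then have "(\<Sum>x\<in>S. (-1) ^ of_bool (ip_code h x) * pmf \<mu> x) =
        (\<Sum>x\<in>rep3 ` S'. (-1) ^ of_bool (ip_code h x) * pmf \<mu> x)"
      by (intro sum.mono_neutral_right) (auto simp: S'_def pmf_eq_0_set_pmf set)
    also have "\<dots> = (\<Sum>y\<in>S'. chi (ip h y)) / 2 ^ (2 * h)"
      using inj_on_subset[OF inj]
      by (simp add: sum.reindex S'_def pmf ip_code_rep3 sum_divide_distrib)
    finally have "bias (ip_code h) \<mu> S = \<bar>\<Sum>y\<in>S'. chi (ip h y)\<bar> / 2 ^ (2 * h)"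
      by (simp add: bias_def)
    also have "\<dots> \<le> 2 ^ h / 2 ^ (2 * h)"
    proof (rule divide_right_mono)
      show "\<bar>\<Sum>y\<in>S'. chi (ip h y)\<bar> \<le> 2 ^ h"
      \<comment> \<open>The preimage of an affine subspace under the injective linear map
        \<open>rep3\<close> is empty or a coset \<open>b + V'\<close>.\<close>
      proof (cases "S' = {}")
        case False
        then obtain b where b: "b \<in> ?Y" "a + rep3 b \<in> V" by (auto simp: S'_def S_iff)
        define V' where "V' = {y\<in>?Y. rep3 y \<in> V}"
        have *: "rep3 (b + y) \<in> V \<longleftrightarrow> a + rep3 y \<in> V" for y
        proof -
          have "rep3 (b + y) = (a + rep3 b) + (a + rep3 y)" "a + rep3 y = (a + rep3 b) + rep3 (b + y)"
            by (auto simp: rep3_add add_ac)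
          then show ?thesis using V(4)[OF b(2)] by metis
        qed
        have "(\<Sum>y\<in>S'. chi (ip h y)) = (\<Sum>x\<in>V'. chi (ip h (b + x)))"
          using b(1) * *[of "b + _"]
          by (intro sum.reindex_bij_witness[of _ "\<lambda>x. b + x" "\<lambda>x. b + x"])
            (auto simp: S'_def V'_def S_iff add_in_cube)
        also have "\<bar>\<dots>\<bar> \<le> 2 ^ h"
          using V by (intro sum_chi_ip_subspace) (auto simp: V'_def rep3_add add_in_cube)
        finally show ?thesis .
      qed simp
    qed simp
    also have "\<dots> = 2 powr - real h"
      unfolding mult_2 by (simp add: powr_minus_divide powr_realpow power_add)
    finally show ?thesis .
  qed
  then have "h \<le> disc_dist n (ip_code h) \<mu>" by (rule disc_dist_geI[OF \<mu>])
  also have "\<dots> \<le> disc n (ip_code h)" by (rule disc_dist_le_disc[OF \<mu>])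
  finally show ?thesis .
qed

subsection \<open>Inner product on a repetition code: product distributions\<close>

text \<open>AM-GM: \<open>(s + t)^2\<close> is at least \<open>4 * s * t = 4 * u * v\<close>, hence
  at least \<open>4 * u^2\<close>.\<close>

lemma double_le_sum_of_prod_eq:
  fixes s t u v :: real
  assumes "0 \<le> s" "0 \<le> t" "0 \<le> u" "u \<le> v" "s * t = u * v"
  shows "2 * u \<le> s + t"
proof (rule power2_le_imp_le)
  have "(2 * u)\<^sup>2 \<le> 4 * (u * v)"
    using mult_left_mono[OF assms(4,3)] by (simp add: power2_eq_square)
  also have "\<dots> \<le> (s + t)\<^sup>2"
    using zero_le_power2[of "s - t"] by (simp add: power2_eq_square algebra_simps flip: assms(5))
  finally show "(2 * u)\<^sup>2 \<le> (s + t)\<^sup>2" .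
qed (use assms in simp)

text \<open>
  The eight outcomes on a block sum to \<open>1\<close>, and by AM-GM each of the three complementary pairs
  of non-codeword outcomes is at least twice the rarer codeword outcome.
\<close>

lemma block_bound:
  fixes a b c :: real
  assumes "0 \<le> a" "a \<le> 1" "0 \<le> b" "b \<le> 1" "0 \<le> c" "c \<le> 1"
    and le: "(1 - a) * (1 - b) * (1 - c) \<le> a * b * c"
  shows "a * b * c + 7 * ((1 - a) * (1 - b) * (1 - c)) \<le> 1"
proof -
  let ?u = "(1 - a) * (1 - b) * (1 - c)"
  have "2 * ?u \<le> (1 - a) * b * c + a * (1 - b) * (1 - c)"
    "2 * ?u \<le> a * (1 - b) * c + (1 - a) * b * (1 - c)"
    "2 * ?u \<le> a * b * (1 - c) + (1 - a) * (1 - b) * c"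
    using assms by (intro double_le_sum_of_prod_eq[where v = "a * b * c"]; simp add: mult_ac)+
  then show ?thesis by (simp add: algebra_simps)
qed

text \<open>Expanding the products, a term that takes \<open>u\<close> at a nonempty set of indices
  occurs on the right with a power of \<open>7\<close> whose exponent is at least one.\<close>

lemma prod_gap:
  fixes u v :: "'a \<Rightarrow> real"
  assumes "finite A" "\<And>i. i \<in> A \<Longrightarrow> 0 \<le> u i" "\<And>i. i \<in> A \<Longrightarrow> 0 \<le> v i"
  shows "7 * ((\<Prod>i\<in>A. v i + u i) - (\<Prod>i\<in>A. v i)) \<le> (\<Prod>i\<in>A. v i + 7 * u i) - (\<Prod>i\<in>A. v i)"
  using assms
proof (induction A rule: finite_induct)
  case (insert j A)
  let ?A = "\<Prod>i\<in>A. v i + u i" and ?B = "\<Prod>i\<in>A. v i" and ?D = "\<Prod>i\<in>A. v i + 7 * u i"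
  have "?A \<le> ?D" using insert by (intro prod_mono) auto
  then have "v j * (7 * (?A - ?B)) + 7 * u j * ?A \<le> v j * (?D - ?B) + 7 * u j * ?D"
    using insert by (intro add_mono mult_left_mono) auto
  then show ?case using insert.hyps by (simp add: algebra_simps)
qed simp

text \<open>For \<open>x\<close> in \<open>E\<close> the vector \<open>x + c\<close> is nonzero, so
  a uniformly random parity separates \<open>x\<close> from \<open>c\<close> half of the time. Some
  parity is at least as good as the average.\<close>

lemma halving_query:
  assumes E: "E \<subseteq> cube n" and c: "c \<in> cube n" "c \<notin> E" and p: "\<And>x. x \<in> E \<Longrightarrow> 0 \<le> p x"
  shows "\<exists>a\<in>cube n. (\<Sum>x\<in>{x\<in>E. inner_F2 n a x = inner_F2 n a c}. p x) \<le> (\<Sum>x\<in>E. p x) / (2::real)"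
proof -
  let ?g = "\<lambda>a. \<Sum>x\<in>E. p x * chi (inner_F2 n a (x + c))"
  have finE: "finite E" using finite_subset[OF E] by simp
  have "(\<Sum>a\<in>cube n. ?g a) = (\<Sum>x\<in>E. p x * (\<Sum>a\<in>cube n. chi (inner_F2 n a (x + c))))"
    by (subst sum.swap) (simp add: sum_distrib_left)
  also have "\<dots> = 0"
  proof (rule sum.neutral, intro ballI)
    fix x assume "x \<in> E"
    then have "x + c \<in> cube n" "x + c \<noteq> 0"
      using E c F2_eq_add_iff[of 0 x c] by (auto simp: add_in_cube)
    then show "p x * (\<Sum>a\<in>cube n. chi (inner_F2 n a (x + c))) = 0"
      using sum_chi_cube by (simp add: inner_F2_commute[of n _ "x + c"])
  qed
  finally have sum0: "(\<Sum>a\<in>cube n. ?g a) = 0" .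
  have ne: "cube n \<noteq> {}" using c by blast
  have "\<not> (\<forall>a\<in>cube n. 0 < ?g a)"
    using sum_pos[of "cube n" ?g] sum0 ne by (metis finite_cube less_irrefl)
  then obtain a where a: "a \<in> cube n" "?g a \<le> 0" by (auto simp: not_less)
  let ?S = "{x\<in>E. inner_F2 n a x = inner_F2 n a c}" and ?N = "{x\<in>E. inner_F2 n a x \<noteq> inner_F2 n a c}"
  have split: "sum g E = sum g ?S + sum g ?N" for g :: "_ \<Rightarrow> real"
    using finE by (subst sum.union_disjoint[symmetric]) (auto intro: sum.cong)
  have "sum (\<lambda>x. p x * chi (inner_F2 n a (x + c))) ?S = sum p ?S"
    by (intro sum.cong) (auto simp: inner_F2_add_right)
  moreover have "sum (\<lambda>x. p x * chi (inner_F2 n a (x + c))) ?N = - sum p ?N"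
  proof -
    have "chi (inner_F2 n a (x + c)) = -1" if "inner_F2 n a x \<noteq> inner_F2 n a c" for x
      using that bit_cases[of "inner_F2 n a x"] bit_cases[of "inner_F2 n a c"]
      by (auto simp: inner_F2_add_right)
    then show ?thesis by (simp flip: sum_negf)
  qed
  ultimately have "sum p ?S \<le> sum p ?N" using a(2) split[of "\<lambda>x. p x * chi (inner_F2 n a (x + c))"] by simp
  then show ?thesis using a(1) split[of p] by (intro bexI[of _ a]) auto
qed

text \<open>Halving queries are repeated on the part of \<open>E\<close> that still agrees with
  \<open>c\<close>; any answer different from that of \<open>c\<close> leads to rejection.\<close>

lemma equality_test:
  assumes "E \<subseteq> cube n" "c \<in> cube n" "c \<notin> E" "\<And>x. x \<in> E \<Longrightarrow> 0 \<le> p x"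
  shows "\<exists>T. pdt_on n T \<and> pdt_depth T \<le> t \<and> pdt_eval n T c \<and>
    (\<Sum>x\<in>{x\<in>E. pdt_eval n T x}. p x) \<le> (\<Sum>x\<in>E. p x) / (2::real) ^ t"
  using assms
proof (induction t arbitrary: E)
  case 0
  then show ?case by (intro exI[of _ "Leaf True"]) simp
next
  case (Suc t)
  obtain a where a: "a \<in> cube n"
    "(\<Sum>x\<in>{x\<in>E. inner_F2 n a x = inner_F2 n a c}. p x) \<le> (\<Sum>x\<in>E. p x) / 2"
    using halving_query[of E n c p] Suc.prems by blast
  let ?E = "{x\<in>E. inner_F2 n a x = inner_F2 n a c}"
  obtain T where T: "pdt_on n T" "pdt_depth T \<le> t" "pdt_eval n T c"
    "(\<Sum>x\<in>{x\<in>?E. pdt_eval n T x}. p x) \<le> (\<Sum>x\<in>?E. p x) / 2 ^ t"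
    using Suc.IH[of ?E] Suc.prems by auto
  \<comment> \<open>The subtree \<open>T\<close> is placed on the side to which \<open>c\<close>
    itself is sent.\<close>
  define T' where "T' = (if inner_F2 n a c = 0 then Query a T (Leaf False) else Query a (Leaf False) T)"
  have "pdt_eval n T' x \<longleftrightarrow> inner_F2 n a x = inner_F2 n a c \<and> pdt_eval n T x" for x
    using bit_cases[of "inner_F2 n a x"] bit_cases[of "inner_F2 n a c"] by (auto simp: T'_def)
  moreover have "(\<Sum>x\<in>?E. p x) / 2 ^ t \<le> (\<Sum>x\<in>E. p x) / 2 / 2 ^ t"
    using a(2) by (rule divide_right_mono) simp
  moreover have "pdt_on n T'" "pdt_depth T' \<le> Suc t" using T a by (auto simp: T'_def)
  ultimately show ?case using T by (intro exI[of _ T']) (auto simp: conj_assoc)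
qed

section \<open>Mass of the repetition code under a product distribution\<close>

lemma prod_lessThan_3_mult:
  fixes g :: "nat \<Rightarrow> 'a::comm_monoid_mult"
  shows "(\<Prod>i<3 * m. g i) = (\<Prod>i<m. g (3 * i) * g (3 * i + 1) * g (3 * i + 2))"
proof (induction m)
  case (Suc m)
  have "{..<3 * Suc m} = insert (3 * m + 2) (insert (3 * m + 1) (insert (3 * m) {..<3 * m}))" by auto
  then show ?case using Suc by (simp add: mult_ac)
qed simp

text \<open>The mass of a codeword factors over blocks. The codeword of \<open>z\<close> takes the
  heavier symbol in each block, so the other codewords have mass \<open>\<kappa>\<close> times the
  gap between the products of \<open>v i + u i\<close> and of \<open>v i\<close>, which
  \<open>prod_gap\<close> and \<open>block_bound\<close> control.\<close>

lemma prob_rep3_code: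
  fixes q :: "nat \<Rightarrow> bit pmf"
  assumes "3 * m \<le> n"
  defines "\<mu> \<equiv> Pi_pmf {..<n} 0 q"
  shows "\<exists>z\<in>cube m. (\<Sum>y\<in>cube m - {z}. pmf \<mu> (rep3 y)) \<le> 1 / 7"
proof -
  define P where "P = (\<lambda>i. pmf (q i))"
  have P1: "P i 0 + P i 1 = 1" for i
    using sum_pmf_eq_1[of "{0, 1}" "q i"] bit_cases by (auto simp: P_def)
  have P: "0 \<le> P i b" "P i b \<le> 1" for i b by (auto simp: P_def pmf_le_1)
  define w where "w = (\<lambda>i b. P (3 * i) b * P (3 * i + 1) b * P (3 * i + 2) b)"
  \<comment> \<open>The probability that all padding coordinates, beyond the \<open>3 * m\<close>
    used by the code, are \<open>0\<close>.\<close>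
  define \<kappa> where "\<kappa> = (\<Prod>i\<in>{3 * m..<n}. P i 0)"
  have \<kappa>: "0 \<le> \<kappa>" "\<kappa> \<le> 1" using P by (auto simp: \<kappa>_def intro!: prod_nonneg prod_le_1)
  have pmf: "pmf \<mu> (rep3 y) = \<kappa> * (\<Prod>i<m. w i (y i))" if y: "y \<in> cube m" for y
  proof -
    have "pmf \<mu> (rep3 y) = (\<Prod>i<n. P i (rep3 y i))"
      unfolding \<mu>_def P_def using rep3_in_cube[OF y assms(1)]
      by (intro pmf_Pi') (auto simp: cube_def)
    also have "\<dots> = (\<Prod>i<3 * m. P i (rep3 y i)) * (\<Prod>i\<in>{3 * m..<n}. P i (rep3 y i))"
      using assms(1) by (subst prod.union_disjoint[symmetric]) (auto intro: prod.cong)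
    also have "(\<Prod>i\<in>{3 * m..<n}. P i (rep3 y i)) = \<kappa>"
      unfolding \<kappa>_def using y by (intro prod.cong) (auto simp: cube_def rep3_def)
    also have "(\<Prod>i<3 * m. P i (rep3 y i)) = (\<Prod>i<m. w i (y i))"
    proof -
      have "(3 * i + 1) div 3 = i" "(3 * i + 2) div 3 = i" for i :: nat by simp_all
      then show ?thesis unfolding prod_lessThan_3_mult w_def rep3_def by simp
    qed
    finally show ?thesis by simp
  qed
  define z where "z = (\<lambda>i. of_bool (i < m \<and> w i 0 < w i 1) :: bit)"
  have z: "z \<in> cube m" by (auto simp: z_def cube_def)
  define v where "v = (\<lambda>i. max (w i 0) (w i 1))"
  define u where "u = (\<lambda>i. min (w i 0) (w i 1))"
  have uv: "0 \<le> u i" "0 \<le> v i" "v i + u i = w i 0 + w i 1" for i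
    using P by (auto simp: u_def v_def w_def le_max_iff_disj)
  have block: "v i + 7 * u i \<le> 1" for i
  proof -
    have "P j 1 = 1 - P j 0" for j using P1[of j] by simp
    then have w1: "w i 1 = (1 - P (3 * i) 0) * (1 - P (3 * i + 1) 0) * (1 - P (3 * i + 2) 0)"
      by (simp add: w_def)
    show ?thesis
    \<comment> \<open>\<open>block_bound\<close> wants the rarer symbol in its complemented role; in
      the second case the parameters are replaced by their complements.\<close>
    proof (cases "w i 1 \<le> w i 0")
      case True
      then show ?thesis
        using block_bound[of "P (3 * i) 0" "P (3 * i + 1) 0" "P (3 * i + 2) 0"] P w1
        by (simp add: u_def v_def w_def)
    next
      case False
      then show ?thesis
        using block_bound[of "1 - P (3 * i) 0" "1 - P (3 * i + 1) 0" "1 - P (3 * i + 2) 0"] P w1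
        by (simp add: u_def v_def w_def)
    qed
  qed
  have "(\<Prod>i<m. w i (z i)) = (\<Prod>i<m. v i)"
    by (intro prod.cong) (auto simp: z_def v_def)
  then have "(\<Sum>y\<in>cube m - {z}. pmf \<mu> (rep3 y)) = \<kappa> * ((\<Prod>i<m. v i + u i) - (\<Prod>i<m. v i))"
    using z by (simp add: sum_diff1 pmf uv(3) right_diff_distrib flip: sum_distrib_left sum_cube_prod)
  also have "\<dots> \<le> \<kappa> * (1 / 7)"
  proof (rule mult_left_mono[OF _ \<kappa>(1)])
    have "(\<Prod>i<m. v i + 7 * u i) \<le> 1" using block uv by (intro prod_le_1) (auto simp: add_nonneg_nonneg)
    moreover have "0 \<le> (\<Prod>i<m. v i)" using uv by (intro prod_nonneg) auto
    ultimately show "(\<Prod>i<m. v i + u i) - (\<Prod>i<m. v i) \<le> 1 / 7"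
      using prod_gap[of "{..<m}" u v] uv by simp
  qed
  also have "\<dots> \<le> 1 / 7" using \<kappa> by simp
  finally show ?thesis using z by blast
qed

text \<open>Only the heaviest codeword \<open>?c\<close> need be answered correctly. Errors come
  from the other codewords, of mass at most \<open>1/7\<close>, and from points wrongly accepted by
  three halving queries, of mass at most \<open>1/8\<close>; together this is
  \<open>15/56 < 1/3\<close>.\<close>

lemma D_prod_ip_code:
  assumes "6 * h \<le> n"
  shows "D_prod n (ip_code h) \<le> 3"
proof (rule D_prod_le)
  fix \<mu> assume \<mu>: "\<mu> \<in> product_dists n"
  then have \<mu>': "\<mu> \<in> dists n" using product_dists_subset by blast
  let ?C = "rep3 ` cube (2 * h)"
  have C: "?C \<subseteq> cube n" using assms by (auto intro!: rep3_in_cube)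
  obtain z where z: "z \<in> cube (2 * h)" "(\<Sum>y\<in>cube (2 * h) - {z}. pmf \<mu> (rep3 y)) \<le> 1 / 7"
    using \<mu> prob_rep3_code[of "2 * h" n] assms by (auto simp: product_dists_def)
  let ?c = "rep3 z"
  have "(\<Sum>x\<in>?C - {?c}. pmf \<mu> x) = (\<Sum>x\<in>rep3 ` (cube (2 * h) - {z}). pmf \<mu> x)"
    by (intro sum.cong) auto
  also have "\<dots> = (\<Sum>y\<in>cube (2 * h) - {z}. pmf \<mu> (rep3 y))"
    by (subst sum.reindex) (auto intro: inj_onI)
  finally have C_le: "(\<Sum>x\<in>?C - {?c}. pmf \<mu> x) \<le> 1 / 7" using z by simp
  have err: "D_err (1/3) n (ip_code h) \<mu> \<le> 3"
    if T: "pdt_on n T" "pdt_depth T \<le> 3" "pdt_eval n T ?c = ip_code h ?c"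
      "(\<Sum>x\<in>{x\<in>cube n - {?c}. pdt_eval n T x}. pmf \<mu> x) \<le> 1 / 8" for T
  proof (rule D_err_le[OF T(1,2)])
    let ?A = "{x\<in>cube n - {?c}. pdt_eval n T x}"
    have "{x. pdt_eval n T x \<noteq> ip_code h x} \<inter> cube n \<subseteq> (?C - {?c}) \<union> ?A"
      using T(3) by (auto simp: ip_code_def)
    then have "measure_pmf.prob \<mu> {x. pdt_eval n T x \<noteq> ip_code h x} \<le> (\<Sum>x\<in>(?C - {?c}) \<union> ?A. pmf \<mu> x)"
      unfolding prob_eq_sum_cube[OF \<mu>'] by (intro sum_mono2) auto
    also have "\<dots> \<le> (\<Sum>x\<in>?C - {?c}. pmf \<mu> x) + (\<Sum>x\<in>?A. pmf \<mu> x)"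
      by (simp add: sum_Un sum_nonneg)
    also have "\<dots> \<le> 1 / 3" using C_le T(4) by simp
    finally show "measure_pmf.prob \<mu> {x. pdt_eval n T x \<noteq> ip_code h x} \<le> 1 / 3" .
  qed
  show "D_err (1/3) n (ip_code h) \<mu> \<le> 3"
  proof (cases "ip_code h ?c")
    case True
    have "(\<Sum>x\<in>cube n - {?c}. pmf \<mu> x) \<le> (\<Sum>x\<in>cube n. pmf \<mu> x)" by (intro sum_mono2) auto
    then have le: "(\<Sum>x\<in>cube n - {?c}. pmf \<mu> x) / 2 ^ 3 \<le> 1 / 8" by (simp add: sum_pmf_cube[OF \<mu>'])
    obtain T where "pdt_on n T" "pdt_depth T \<le> 3" "pdt_eval n T ?c"
      "(\<Sum>x\<in>{x\<in>cube n - {?c}. pdt_eval n T x}. pmf \<mu> x) \<le> (\<Sum>x\<in>cube n - {?c}. pmf \<mu> x) / 2 ^ 3"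
      using equality_test[of "cube n - {?c}" n ?c "pmf \<mu>" 3] C z(1) by auto
    then show ?thesis using True le by (intro err[of T]) auto
  next
    case False
    then show ?thesis by (intro err[of "Leaf False"]) auto
  qed
qed

subsection \<open>Leaves of parity decision trees\<close>

text \<open>The linear span of the list, built one generator at a time to match the induction on the
  query history.\<close>

primrec par_span :: "(nat \<Rightarrow> bit) list \<Rightarrow> (nat \<Rightarrow> bit) set" where
  "par_span [] = {0}"
| "par_span (a # as) = par_span as \<union> (+) a ` par_span as"

text \<open>The inputs consistent with a history of queries and answers: an affine subspace, or
  empty if the answers contradict each other.\<close>

definition leaf :: "nat \<Rightarrow> ((nat \<Rightarrow> bit) \<times> bit) list \<Rightarrow> (nat \<Rightarrow> bit) set" where
  "leaf n q = {x\<in>cube n. \<forall>(a, b)\<in>set q. inner_F2 n a x = b}"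

lemma finite_leaf [simp]: "finite (leaf n q)"
  by (simp add: leaf_def)

lemma leaf_Nil [simp]: "leaf n [] = cube n"
  by (simp add: leaf_def)

lemma leaf_Cons: "leaf n ((a, b) # q) = {x\<in>leaf n q. inner_F2 n a x = b}"
  by (auto simp: leaf_def)

lemma finite_par_span [simp]: "finite (par_span as)"
  by (induction as) auto

lemma card_par_span: "card (par_span as) \<le> 2 ^ length as"
proof (induction as)
  case (Cons a as)
  have "card (par_span (a # as)) \<le> card (par_span as) + card ((+) a ` par_span as)"
    by (simp add: card_Un_le)
  also have "\<dots> \<le> card (par_span as) + card (par_span as)"
    by (simp add: card_image_le)
  finally show ?case using Cons by simp
qed simp

text \<open>Zero queries pad a short history to an exact length without changing its span.\<close>

lemma par_span_replicate_0 [simp]: "par_span (replicate r 0 @ as) = par_span as"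
proof -
  have "par_span (replicate r z @ as) = par_span as" if "(+) z = (\<lambda>x. x)" for z
    using that by (induction r) simp_all
  then show ?thesis by (simp add: fun_eq_iff)
qed

text \<open>The indicator of \<open>inner_F2 n a x = b\<close> is
  \<open>(1 + chi b * chi (inner_F2 n a x)) / 2\<close>.\<close>

lemma sum_leaf_Cons:
  fixes g :: "(nat \<Rightarrow> bit) \<Rightarrow> real"
  shows "(\<Sum>x\<in>leaf n ((a, b) # q). g x) =
    ((\<Sum>x\<in>leaf n q. g x) + chi b * (\<Sum>x\<in>leaf n q. g x * chi (inner_F2 n a x))) / 2"
proof -
  have "(\<Sum>x\<in>leaf n ((a, b) # q). g x) = (\<Sum>x\<in>leaf n q. if inner_F2 n a x = b then g x else 0)"
    by (simp add: leaf_Cons sum.inter_filter)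
  also have "\<dots> = (\<Sum>x\<in>leaf n q. (g x + chi b * (g x * chi (inner_F2 n a x))) / 2)"
  proof (rule sum.cong)
    fix x
    show "(if inner_F2 n a x = b then g x else 0) = (g x + chi b * (g x * chi (inner_F2 n a x))) / 2"
      using bit_cases[of b] bit_cases[of "inner_F2 n a x"] by auto
  qed simp
  finally show ?thesis by (simp add: sum.distrib sum_distrib_left flip: sum_divide_distrib)
qed

text \<open>Removing the query \<open>a\<close> turns the sum into a combination of the character
  sums for \<open>u\<close> and \<open>u + a\<close> over the shorter history, and neither vector
  lies in the shorter span.\<close>

lemma sum_chi_leaf:
  assumes "u \<in> cube n" "fst ` set q \<subseteq> cube n" "u \<notin> par_span (map fst q)"
  shows "(\<Sum>x\<in>leaf n q. chi (inner_F2 n u x)) = 0"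
  using assms
proof (induction q arbitrary: u)
  case Nil
  then show ?case using sum_chi_cube by simp
next
  case (Cons c q)
  obtain a b where c: "c = (a, b)" by (cases c)
  obtain v where v: "v = u + a" by blast
  have "v \<notin> par_span (map fst q)"
  proof
    assume "v \<in> par_span (map fst q)"
    then have "a + v \<in> (+) a ` par_span (map fst q)" by (rule imageI)
    moreover have "a + v = u" unfolding v by (metis F2_add_cancel add.commute)
    ultimately show False using Cons.prems(3) by (simp add: c)
  qed
  moreover have "v \<in> cube n" using Cons.prems by (simp add: c v add_in_cube)
  ultimately have "(\<Sum>x\<in>leaf n q. chi (inner_F2 n v x)) = 0"
    using Cons.IH[of v] Cons.prems(2) by simp
  moreover have "(\<Sum>x\<in>leaf n q. chi (inner_F2 n u x)) = 0"
    using Cons.prems by (intro Cons.IH) auto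
  ultimately show ?case by (simp add: c v sum_leaf_Cons inner_F2_add_left chi_add)
qed

lemma card_leaf_Cons:
  assumes "u \<in> cube n" "fst ` set q \<subseteq> cube n" "u \<notin> par_span (map fst q)"
  shows "real (card (leaf n ((u, b) # q))) = card (leaf n q) / 2"
  using sum_leaf_Cons[of "\<lambda>_. 1" n u b q] sum_chi_leaf[OF assms] by simp

text \<open>The last hypothesis is linear independence of the rows modulo the span of the queries.
  Each row therefore halves the leaf, and the condition survives when that row joins the
  history.\<close>

lemma card_leaf_independent:
  fixes R :: "'p \<Rightarrow> nat \<Rightarrow> bit"
  assumes "finite P" "\<And>p. p \<in> P \<Longrightarrow> R p \<in> cube n" "fst ` set q \<subseteq> cube n"
    and "\<And>X. X \<subseteq> P \<Longrightarrow> X \<noteq> {} \<Longrightarrow> (\<Sum>p\<in>X. R p) \<notin> par_span (map fst q)"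
  shows "real (card {x\<in>leaf n q. \<forall>p\<in>P. inner_F2 n (R p) x = 0}) = card (leaf n q) / 2 ^ card P"
  using assms
proof (induction P arbitrary: q rule: finite_induct)
  case (insert p P)
  let ?q = "(R p, 0) # q"
  have "{x\<in>leaf n q. \<forall>p\<in>insert p P. inner_F2 n (R p) x = 0} =
      {x\<in>leaf n ?q. \<forall>p\<in>P. inner_F2 n (R p) x = 0}"
    by (auto simp: leaf_Cons)
  also have "real (card \<dots>) = card (leaf n ?q) / 2 ^ card P"
  proof (rule insert.IH)
    fix X assume X: "X \<subseteq> P" "X \<noteq> {}"
    then have fin: "finite X" "p \<notin> X" using insert.hyps finite_subset by auto
    have "(\<Sum>p\<in>X. R p) \<notin> (+) (R p) ` par_span (map fst q)"
    proof
      assume "(\<Sum>p\<in>X. R p) \<in> (+) (R p) ` par_span (map fst q)"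
      then have "(\<Sum>p\<in>insert p X. R p) \<in> par_span (map fst q)" using fin by auto
      then show False using insert.prems(3)[of "insert p X"] X by auto
    qed
    moreover have "(\<Sum>p\<in>X. R p) \<notin> par_span (map fst q)" using insert.prems(3)[of X] X by auto
    ultimately show "(\<Sum>p\<in>X. R p) \<notin> par_span (map fst ?q)" by simp
  qed (use insert.prems in auto)
  also have "real (card (leaf n ?q)) = card (leaf n q) / 2"
    using insert.prems insert.prems(3)[of "{p}"] by (intro card_leaf_Cons) auto
  finally show ?case using insert.hyps by (simp add: divide_divide_eq_left)
qed simp

text \<open>A leaf labelled \<open>1\<close> errs on every zero of \<open>f\<close>. A leaf labelled
  \<open>0\<close> errs on a fraction at least \<open>1/2 - 1/128\<close>, while zeros fill at most
  \<open>1/2 + 1/128\<close>; so zeros exceed errors by at most \<open>1/64\<close> of the leaf. The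
  excess adds up over the tree.\<close>

lemma pdt_error_ge:
  fixes f :: "(nat \<Rightarrow> bit) \<Rightarrow> bool"
  assumes dense: "\<And>q. length q \<le> d \<Longrightarrow> fst ` set q \<subseteq> cube n \<Longrightarrow>
      (1/2 - 1/128) * card (leaf n q) \<le> real (card {x\<in>leaf n q. f x})"
    and "pdt_on n T" "length q + pdt_depth T \<le> d" "fst ` set q \<subseteq> cube n"
  shows "real (card {x\<in>leaf n q. \<not> f x}) - card (leaf n q) / 64 \<le>
      card {x\<in>leaf n q. pdt_eval n T x \<noteq> f x}"
  using assms(2-)
proof (induction T arbitrary: q)
  case (Leaf b)
  have "card (leaf n q) = card {x\<in>leaf n q. f x} + card {x\<in>leaf n q. \<not> f x}"
    by (subst card_Un_disjoint[symmetric]) (auto intro: arg_cong[where f = card])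
  then have "real (card (leaf n q)) = card {x\<in>leaf n q. f x} + card {x\<in>leaf n q. \<not> f x}"
    by simp
  then show ?case using dense[of q] Leaf by (cases b) (auto simp: field_simps)
next
  case (Query a T0 T1)
  let ?q = "\<lambda>b. (a, b) # q"
  have split: "card {x\<in>leaf n q. Q x} = card {x\<in>leaf n (?q 0). Q x} + card {x\<in>leaf n (?q 1). Q x}" for Q
  proof -
    have "{x\<in>leaf n q. Q x} = {x\<in>leaf n (?q 0). Q x} \<union> {x\<in>leaf n (?q 1). Q x}"
      using bit_cases by (auto simp: leaf_Cons)
    then show ?thesis by (subst card_Un_disjoint[symmetric]) (auto simp: leaf_Cons)
  qed
  have "{x\<in>leaf n (?q 0). pdt_eval n (Query a T0 T1) x \<noteq> f x} = {x\<in>leaf n (?q 0). pdt_eval n T0 x \<noteq> f x}"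
    "{x\<in>leaf n (?q 1). pdt_eval n (Query a T0 T1) x \<noteq> f x} = {x\<in>leaf n (?q 1). pdt_eval n T1 x \<noteq> f x}"
    by (auto simp: leaf_Cons)
  moreover have "Suc (length q + pdt_depth T0) \<le> d" "Suc (length q + pdt_depth T1) \<le> d"
    using Query.prems(2) by auto
  ultimately have "real (card {x\<in>leaf n (?q 0). \<not> f x}) - card (leaf n (?q 0)) / 64 \<le>
      card {x\<in>leaf n (?q 0). pdt_eval n (Query a T0 T1) x \<noteq> f x}"
    "real (card {x\<in>leaf n (?q 1). \<not> f x}) - card (leaf n (?q 1)) / 64 \<le>
      card {x\<in>leaf n (?q 1). pdt_eval n (Query a T0 T1) x \<noteq> f x}"
    using Query.IH(1)[of "?q 0"] Query.IH(2)[of "?q 1"] Query.prems by simp_all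
  then have "real (card {x\<in>leaf n (?q 0). \<not> f x}) + card {x\<in>leaf n (?q 1). \<not> f x} -
      (real (card (leaf n (?q 0))) + card (leaf n (?q 1))) / 64 \<le>
      real (card {x\<in>leaf n (?q 0). pdt_eval n (Query a T0 T1) x \<noteq> f x}) +
      card {x\<in>leaf n (?q 1). pdt_eval n (Query a T0 T1) x \<noteq> f x}"
    unfolding add_divide_distrib by linarith
  then show ?case
    using split[of "\<lambda>_. True"]
    unfolding split[of "\<lambda>x. pdt_eval n (Query a T0 T1) x \<noteq> f x"] split[of "\<lambda>x. \<not> f x"]
    by simp
qed

subsection \<open>Unions of subspaces\<close>

text \<open>\<open>R (i, l)\<close> is the \<open>l\<close>-th parity check of the
  \<open>i\<close>-th subspace; no independence of the rows is imposed.\<close>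

definition subspace_union :: "nat \<Rightarrow> nat \<Rightarrow> nat \<Rightarrow> (nat \<times> nat \<Rightarrow> nat \<Rightarrow> bit) \<Rightarrow> (nat \<Rightarrow> bit) \<Rightarrow> bool" where
  "subspace_union n M k R x \<longleftrightarrow> (\<exists>i<M. \<forall>l<k. inner_F2 n (R (i, l)) x = 0)"

text \<open>
  With \<open>N\<close> the number of subspaces containing a point, the sign of \<open>1 - 2 * N\<close> computes the
  function, so the function correlates with one of the subspaces under every distribution.
\<close>

lemma disc_subspace_union: "disc n (subspace_union n M k R) \<le> log 2 (2 * real M + 1)"
proof (rule disc_le)
  fix \<mu> assume \<mu>: "\<mu> \<in> dists n"
  let ?f = "subspace_union n M k R"
  define B where "B = (MAX S\<in>affine_subspaces n. bias ?f \<mu> S)"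
  define F where "F = (\<lambda>x. (-1) ^ of_bool (?f x) :: real)"
  define A where "A = (\<lambda>i. {x\<in>cube n. \<forall>l<k. inner_F2 n (R (i, l)) x = 0})"
  define N where "N = (\<lambda>x. \<Sum>i<M. of_bool (x \<in> A i) :: real)"
  have bias_le: "bias ?f \<mu> S \<le> B" if "S \<in> affine_subspaces n" for S
    unfolding B_def using that by (intro Max_ge) auto
  have A: "A i \<in> affine_subspaces n" for i
    by (rule subspace_in_affine_subspaces)
      (auto simp: A_def subspace_F2_iff add_in_cube inner_F2_add_right)
  have pointwise: "1 \<le> F x * (1 - 2 * N x)" if "x \<in> cube n" for x
  proof (cases "?f x")
    case True
    then obtain i where "i < M" "\<forall>l<k. inner_F2 n (R (i, l)) x = 0"
      unfolding subspace_union_def by auto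
    then have i: "i < M" "x \<in> A i" using that by (simp_all add: A_def)
    have "of_bool (x \<in> A i) \<le> N x" unfolding N_def using i by (intro member_le_sum) auto
    then show ?thesis using True i by (simp add: F_def)
  next
    case False
    then have "N x = 0" unfolding N_def by (intro sum.neutral) (auto simp: subspace_union_def A_def)
    then show ?thesis using False by (simp add: F_def)
  qed
  have "1 = (\<Sum>x\<in>cube n. pmf \<mu> x * 1)" by (simp add: sum_pmf_cube[OF \<mu>])
  also have "\<dots> \<le> (\<Sum>x\<in>cube n. pmf \<mu> x * (F x * (1 - 2 * N x)))"
    using pointwise by (intro sum_mono mult_left_mono) auto
  also have "\<dots> = (\<Sum>x\<in>cube n. F x * pmf \<mu> x) - 2 * (\<Sum>x\<in>cube n. F x * pmf \<mu> x * N x)"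
    by (simp add: sum_distrib_left algebra_simps flip: sum_subtractf)
  also have "(\<Sum>x\<in>cube n. F x * pmf \<mu> x * N x) = (\<Sum>i<M. \<Sum>x\<in>cube n. F x * pmf \<mu> x * of_bool (x \<in> A i))"
    unfolding N_def sum_distrib_left by (rule sum.swap)
  also have "\<dots> = (\<Sum>i<M. \<Sum>x\<in>A i. F x * pmf \<mu> x)"
  proof (rule sum.cong)
    fix i
    have "(\<Sum>x\<in>cube n. F x * pmf \<mu> x * of_bool (x \<in> A i)) = (\<Sum>x\<in>cube n \<inter> A i. F x * pmf \<mu> x)"
      unfolding sum.inter_restrict[OF finite_cube] by (intro sum.cong) auto
    also have "cube n \<inter> A i = A i" by (auto simp: A_def)
    finally show "(\<Sum>x\<in>cube n. F x * pmf \<mu> x * of_bool (x \<in> A i)) = (\<Sum>x\<in>A i. F x * pmf \<mu> x)" .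
  qed simp
  also have "(\<Sum>x\<in>cube n. F x * pmf \<mu> x) - 2 * (\<Sum>i<M. \<Sum>x\<in>A i. F x * pmf \<mu> x) \<le> B + 2 * (\<Sum>i<M. B)"
  proof -
    have "(\<Sum>x\<in>cube n. F x * pmf \<mu> x) \<le> B"
      using bias_le[OF cube_in_affine_subspaces] by (auto simp: bias_def F_def)
    moreover have "(\<Sum>i<M. - (\<Sum>x\<in>A i. F x * pmf \<mu> x)) \<le> (\<Sum>i<M. B)"
    proof (rule sum_mono)
      fix i show "- (\<Sum>x\<in>A i. F x * pmf \<mu> x) \<le> B"
        using bias_le[OF A[of i]] unfolding bias_def F_def by linarith
    qed
    ultimately show ?thesis unfolding sum_negf by linarith
  qed
  finally have B: "1 \<le> (2 * real M + 1) * B" by (simp add: algebra_simps)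
  have "0 < B" unfolding B_def by (rule Max_bias_pos[OF \<mu>])
  have "- log 2 B = log 2 (1 / B)" using \<open>0 < B\<close> by (simp add: log_divide)
  also have "\<dots> \<le> log 2 (2 * real M + 1)"
    using \<open>0 < B\<close> B by (subst log_le_cancel_iff) (auto simp: field_simps)
  finally show "disc_dist n ?f \<mu> \<le> log 2 (2 * real M + 1)" by (simp add: disc_dist_def B_def)
qed

text \<open>
  Second-order Bonferroni: if \<open>Z\<close> counts the subspaces with index in \<open>I\<close> that contain a point, then
  \<open>1[Z > 0] \<ge> (3 * Z - Z\<^sup>2) / 2\<close>, and pairwise independence determines both moments.
\<close>

lemma leaf_density:
  assumes R: "\<And>i l. i < M \<Longrightarrow> l < k \<Longrightarrow> R (i, l) \<in> cube n" and q: "fst ` set q \<subseteq> cube n"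
    and M: "M = 2 ^ k" and I: "I \<subseteq> {..<M}" "7 * M \<le> 8 * card I"
    and indep: "\<And>i j X. i \<in> I \<Longrightarrow> j \<in> I \<Longrightarrow> X \<subseteq> {i, j} \<times> {..<k} \<Longrightarrow> X \<noteq> {} \<Longrightarrow>
      (\<Sum>p\<in>X. R p) \<notin> par_span (map fst q)"
  shows "(1/2 - 1/128) * card (leaf n q) \<le> real (card {x\<in>leaf n q. subspace_union n M k R x})"
proof -
  let ?V = "leaf n q" and ?f = "subspace_union n M k R"
  define L where "L = real (card ?V)"
  define lam where "lam = real (card I) / M"
  define A where "A = (\<lambda>i. {x\<in>?V. \<forall>l<k. inner_F2 n (R (i, l)) x = 0})"
  define Z where "Z = (\<lambda>x. \<Sum>i\<in>I. of_bool (x \<in> A i) :: real)"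
  have finI: "finite I" using I(1) finite_subset by auto
  have M0: "real M > 0" using M by simp
  have cardI: "card I \<le> M" using card_mono[OF _ I(1)] by simp
  have A1: "real (card (A i)) = L / M" if "i \<in> I" for i
  proof -
    have "A i = {x\<in>?V. \<forall>p\<in>{i} \<times> {..<k}. inner_F2 n (R p) x = 0}" by (auto simp: A_def)
    also have "real (card \<dots>) = card ?V / 2 ^ card ({i} \<times> {..<k})"
      using R q indep[of i i] that I(1) by (intro card_leaf_independent) auto
    finally show ?thesis by (simp add: L_def M)
  qed
  have A2: "real (card (A i \<inter> A j)) = L / M\<^sup>2" if "i \<in> I" "j \<in> I" "i \<noteq> j" for i j
  proof -
    have "A i \<inter> A j = {x\<in>?V. \<forall>p\<in>{i, j} \<times> {..<k}. inner_F2 n (R p) x = 0}" by (auto simp: A_def)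
    also have "real (card \<dots>) = card ?V / 2 ^ card ({i, j} \<times> {..<k})"
      using R q indep[of i j] that I(1) by (intro card_leaf_independent) auto
    finally show ?thesis
      using that(3) by (simp add: L_def M power2_eq_square card_cartesian_product mult_2 power_add)
  qed
  have count: "(\<Sum>x\<in>?V. of_bool (P x)) = real (card {x\<in>?V. P x})" for P
    by (simp add: sum.If_cases of_bool_def Int_def)
  have "(\<Sum>x\<in>?V. Z x) = (\<Sum>i\<in>I. \<Sum>x\<in>?V. of_bool (x \<in> A i))"
    unfolding Z_def by (rule sum.swap)
  also have "\<dots> = (\<Sum>i\<in>I. L / M)"
  proof (rule sum.cong)
    fix i assume "i \<in> I"
    moreover have "{x\<in>?V. x \<in> A i} = A i" by (auto simp: A_def)
    ultimately show "(\<Sum>x\<in>?V. of_bool (x \<in> A i)) = L / M" by (simp only: count A1)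
  qed simp
  finally have Z1: "(\<Sum>x\<in>?V. Z x) = lam * L" by (simp add: lam_def)
  have "(\<Sum>x\<in>?V. (Z x)\<^sup>2) = (\<Sum>x\<in>?V. \<Sum>i\<in>I. \<Sum>j\<in>I. of_bool (x \<in> A i \<inter> A j))"
    by (simp add: Z_def power2_eq_square sum_product of_bool_conj)
  also have "\<dots> = (\<Sum>i\<in>I. \<Sum>x\<in>?V. \<Sum>j\<in>I. of_bool (x \<in> A i \<inter> A j))"
    by (rule sum.swap)
  also have "\<dots> = (\<Sum>i\<in>I. \<Sum>j\<in>I. \<Sum>x\<in>?V. of_bool (x \<in> A i \<inter> A j))"
    by (intro sum.cong sum.swap) simp
  also have "\<dots> = (\<Sum>i\<in>I. \<Sum>j\<in>I. real (card (A i \<inter> A j)))"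
  proof (intro sum.cong refl)
    fix i j
    have "{x\<in>?V. x \<in> A i \<inter> A j} = A i \<inter> A j" by (auto simp: A_def)
    then show "(\<Sum>x\<in>?V. of_bool (x \<in> A i \<inter> A j)) = real (card (A i \<inter> A j))" by (simp only: count)
  qed
  \<comment> \<open>Adding \<open>L / M^2\<close> on the diagonal as well is harmless and puts the
    double sum in closed form.\<close>
  also have "\<dots> \<le> (\<Sum>i\<in>I. \<Sum>j\<in>I. (if i = j then L / M else 0) + L / M\<^sup>2)"
  proof (intro sum_mono)
    fix i j assume "i \<in> I" "j \<in> I"
    then show "real (card (A i \<inter> A j)) \<le> (if i = j then L / M else 0) + L / M\<^sup>2"
      using A1 A2 by (auto simp: L_def)
  qed
  also have "\<dots> = lam * L + lam\<^sup>2 * L"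
    using finI by (simp add: sum.distrib lam_def power2_eq_square distrib_left)
  finally have Z2: "(\<Sum>x\<in>?V. (Z x)\<^sup>2) \<le> lam * L + lam\<^sup>2 * L" .
  have pointwise: "(3 * Z x - (Z x)\<^sup>2) / 2 \<le> of_bool (?f x)" if "x \<in> ?V" for x
  proof -
    define m where "m = card {i\<in>I. x \<in> A i}"
    have Zm: "Z x = real m" using finI by (simp add: Z_def m_def sum.If_cases of_bool_def Int_def)
    show ?thesis
    proof (cases "m = 0")
      case False
      then obtain i where "i \<in> I" "x \<in> A i" unfolding m_def by (metis (mono_tags, lifting) Collect_empty_eq card.empty)
      then have f: "?f x" using I(1) by (auto simp: subspace_union_def A_def)
      have "m = 1 \<or> 2 \<le> m" using False by auto
      \<comment> \<open>For a positive integer \<open>m\<close>,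
        \<open>1 - (3 * m - m^2) / 2\<close> equals \<open>(m - 1) * (m - 2) / 2\<close>, which is
        nonnegative.\<close>
      then have "0 \<le> (real m - 1) * (real m - 2)" by (auto intro: mult_nonneg_nonneg)
      then show ?thesis using f by (simp add: Zm power2_eq_square algebra_simps)
    qed (simp add: Zm)
  qed
  have lam: "7/8 \<le> lam" "lam \<le> 1" using I(2) cardI M0 by (auto simp: lam_def field_simps)
  \<comment> \<open>\<open>lam - lam^2 / 2\<close> equals \<open>1/2 - (1 - lam)^2 / 2\<close>, and
    \<open>1 - lam\<close> is at most \<open>1/8\<close>; this is the origin of
    \<open>1/128\<close>.\<close>
  have "0 \<le> (1/8 - (1 - lam)) * (1/8 + (1 - lam))" using lam by (intro mult_nonneg_nonneg) auto
  then have "1/2 - 1/128 \<le> lam - lam\<^sup>2 / 2" by (simp add: power2_eq_square algebra_simps)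
  then have "(1/2 - 1/128) * L \<le> (lam - lam\<^sup>2 / 2) * L" by (rule mult_right_mono) (simp add: L_def)
  also have "\<dots> = (3 * (lam * L) - (lam * L + lam\<^sup>2 * L)) / 2" by (simp add: field_simps)
  also have "\<dots> \<le> (3 * (\<Sum>x\<in>?V. Z x) - (\<Sum>x\<in>?V. (Z x)\<^sup>2)) / 2"
    unfolding Z1 using Z2 by (intro divide_right_mono diff_left_mono) auto
  also have "\<dots> = (\<Sum>x\<in>?V. (3 * Z x - (Z x)\<^sup>2) / 2)"
    by (simp add: sum_subtractf sum_distrib_left flip: sum_divide_distrib)
  also have "\<dots> \<le> (\<Sum>x\<in>?V. of_bool (?f x))" using pointwise by (rule sum_mono)
  also have "\<dots> = real (card {x\<in>?V. ?f x})" by (rule count)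
  finally show ?thesis by (simp add: L_def)
qed

subsection \<open>Random subspaces\<close>

text \<open>Each \<open>X t\<close> gets a representative \<open>r t\<close>. By disjointness,
  \<open>R\<close> is recovered from its entries off the representatives and the sums over the
  \<open>X t\<close>, each of which has at most \<open>card W\<close> values. So every constraint
  costs a factor \<open>card W / 2 ^ n\<close>, stated without division.\<close>

lemma card_forced_sums:
  fixes X :: "'t \<Rightarrow> 'p set" and W :: "(nat \<Rightarrow> bit) set"
  assumes "finite P" "finite T" "finite W" "disjoint_family_on X T"
    and X: "\<And>t. t \<in> T \<Longrightarrow> X t \<subseteq> P" "\<And>t. t \<in> T \<Longrightarrow> X t \<noteq> {}"
  shows "card {R\<in>P \<rightarrow>\<^sub>E cube n. \<forall>t\<in>T. (\<Sum>p\<in>X t. R p) \<in> W} * (2 ^ n) ^ card T \<le>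
    card (P \<rightarrow>\<^sub>E cube n) * card W ^ card T"
proof -
  let ?S = "{R\<in>P \<rightarrow>\<^sub>E cube n. \<forall>t\<in>T. (\<Sum>p\<in>X t. R p) \<in> W}"
  obtain r where r: "\<And>t. t \<in> T \<Longrightarrow> r t \<in> X t" using bchoice[of T "\<lambda>t p. p \<in> X t"] X(2) by blast
  have r_unique: "s = t" if "s \<in> T" "t \<in> T" "r s \<in> X t" for s t
    using assms(4) r that unfolding disjoint_family_on_def by blast
  have inj_r: "inj_on r T" using r r_unique by (metis inj_onI)
  let ?Q = "r ` T"
  have Q: "?Q \<subseteq> P" using r X(1) by blast
  define \<Phi> where "\<Phi> = (\<lambda>R. (restrict R (P - ?Q), \<lambda>t\<in>T. \<Sum>p\<in>X t. R p :: nat \<Rightarrow> bit))"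
  have "inj_on \<Phi> ?S"
  proof (rule inj_onI)
    fix R R' assume RR': "R \<in> ?S" "R' \<in> ?S" "\<Phi> R = \<Phi> R'"
    have fst_eq: "restrict R (P - ?Q) = restrict R' (P - ?Q)"
      and snd_eq: "(\<lambda>t\<in>T. \<Sum>p\<in>X t. R p) = (\<lambda>t\<in>T. \<Sum>p\<in>X t. R' p)"
      using RR'(3) unfolding \<Phi>_def by simp_all
    have off: "R p = R' p" if "p \<in> P - ?Q" for p
      using fun_cong[OF fst_eq, of p] that by simp
    have sums: "(\<Sum>p\<in>X t. R p) = (\<Sum>p\<in>X t. R' p)" if "t \<in> T" for t
      using fun_cong[OF snd_eq, of t] that by simp
    have on: "R (r t) = R' (r t)" if t: "t \<in> T" for t
    proof -
      have fin: "finite (X t)" using X(1)[OF t] assms(1) finite_subset by blast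
      have "(\<Sum>p\<in>X t - {r t}. R p) = (\<Sum>p\<in>X t - {r t}. R' p)"
        using r_unique t X(1) by (intro sum.cong refl off) blast
      then show ?thesis
        using sums[OF t] r[OF t] fin by (simp add: sum.remove[of "X t" "r t"])
    qed
    show "R = R'"
      using RR'(1,2) off on by (intro PiE_ext[of R P "\<lambda>_. cube n" R']) auto
  qed
  moreover have "\<Phi> ` ?S \<subseteq> ((P - ?Q) \<rightarrow>\<^sub>E cube n) \<times> (T \<rightarrow>\<^sub>E W)"
    by (auto simp: \<Phi>_def)
  ultimately have "card ?S \<le> card (((P - ?Q) \<rightarrow>\<^sub>E cube n) \<times> (T \<rightarrow>\<^sub>E W))"
    by (rule card_inj_on_le) (use assms in \<open>auto intro!: finite_PiE\<close>)
  also have "\<dots> = (2 ^ n) ^ (card P - card T) * card W ^ card T"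
    using assms(1,2) Q inj_r
    by (simp add: card_cartesian_product card_PiE card_cube card_Diff_subset card_image)
  finally have "card ?S * (2 ^ n) ^ card T \<le>
      (2 ^ n) ^ (card P - card T) * card W ^ card T * (2 ^ n) ^ card T"
    by (rule mult_right_mono) simp
  also have "\<dots> = (2 ^ n) ^ (card P - card T + card T) * card W ^ card T"
    by (simp add: power_add mult_ac)
  also have "card P - card T + card T = card P"
    using card_mono[OF assms(1) Q] inj_r by (simp add: card_image)
  also have "(2 ^ n) ^ card P = card (P \<rightarrow>\<^sub>E cube n)"
    using assms(1) by (simp add: card_PiE card_cube)
  finally show ?thesis .
qed

text \<open>The index sets whose row sums must avoid the span for pairwise independence of the
  subspaces; \<open>i = j\<close> is allowed.\<close>

definition pair_sets :: "nat \<Rightarrow> nat \<Rightarrow> (nat \<times> nat) set set" where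
  "pair_sets M k = (\<Union>i<M. \<Union>j<M. Pow ({i, j} \<times> {..<k})) - {{}}"

lemma pair_sets_iff:
  "X \<in> pair_sets M k \<longleftrightarrow> X \<noteq> {} \<and> (\<exists>i<M. \<exists>j<M. X \<subseteq> {i, j} \<times> {..<k})"
  by (auto simp: pair_sets_def)

lemma finite_pair_sets [simp]: "finite (pair_sets M k)"
  by (simp add: pair_sets_def)

lemma card_pair_sets: "card (pair_sets M k) \<le> M * M * 2 ^ (2 * k)"
proof -
  have pow: "card (Pow ({i, j} \<times> {..<k})) \<le> 2 ^ (2 * k)" for i j :: nat
  proof -
    have "card ({i, j} \<times> {..<k}) \<le> 2 * k"
      by (simp add: card_cartesian_product card_insert_if)
    then show ?thesis by (simp only: card_Pow finite_cartesian_product finite.intros finite_lessThan) simp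
  qed
  have "card (pair_sets M k) \<le> card (\<Union>i<M. \<Union>j<M. Pow ({i, j} \<times> {..<k}))"
    unfolding pair_sets_def by (rule card_mono) auto
  also have "\<dots> \<le> (\<Sum>i<M. card (\<Union>j<M. Pow ({i, j} \<times> {..<k})))"
    by (rule card_UN_le) simp
  also have "\<dots> \<le> (\<Sum>i<M. \<Sum>j<M. card (Pow ({i, j} \<times> {..<k})))"
    by (intro sum_mono card_UN_le) simp
  also have "\<dots> \<le> (\<Sum>i<M. \<Sum>j<M. 2 ^ (2 * k))"
    by (intro sum_mono pow)
  finally show ?thesis by (simp add: mult.assoc)
qed

text \<open>Disjointness of the dependent index sets makes the \<open>s\<close> events independent
  for random rows, so that their probabilities multiply.\<close>

definition colliding :: "nat \<Rightarrow> nat \<Rightarrow> nat \<Rightarrow> (nat \<Rightarrow> bit) list \<Rightarrow> (nat \<times> nat \<Rightarrow> nat \<Rightarrow> bit) \<Rightarrow> bool" where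
  "colliding M k s as R \<longleftrightarrow> (\<exists>X. (\<forall>t<s. X t \<in> pair_sets M k \<and> (\<Sum>p\<in>X t. R p) \<in> par_span as) \<and>
     disjoint_family_on X {..<s})"

text \<open>Union bound over \<open>2 ^ (n * d)\<close> query lists and at most
  \<open>2 ^ (4 * k * n)\<close> families of \<open>n\<close> index sets, each family colliding with
  probability at most \<open>2 ^ (d * n) / 2 ^ (n * n)\<close>. The hypotheses give
  \<open>2 * n * d\<close> at most \<open>n^2 / 2\<close> and \<open>4 * k * n + n\<close> at most
  \<open>n^2 / 2\<close>, leaving a factor \<open>2 ^ n\<close> to spare.\<close>

lemma card_colliding:
  fixes P :: "(nat \<times> nat) set"
  assumes "P = {..<2 ^ k} \<times> {..<k}" "4 * d \<le> n" "8 * k + 2 \<le> n"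
  shows "card {R\<in>P \<rightarrow>\<^sub>E cube n. \<exists>as. set as \<subseteq> cube n \<and> length as = d \<and> colliding (2 ^ k) k n as R} * 2 ^ n
    \<le> card (P \<rightarrow>\<^sub>E cube n)"
proof -
  let ?Om = "P \<rightarrow>\<^sub>E cube n"
  let ?L = "{as. set as \<subseteq> cube n \<and> length as = d}"
  let ?XX = "{X\<in>{..<n} \<rightarrow>\<^sub>E pair_sets (2 ^ k) k. disjoint_family_on X {..<n}}"
  define S where "S = (\<lambda>as X. {R\<in>?Om. \<forall>t\<in>{..<n}. (\<Sum>p\<in>X t. R p) \<in> par_span as})"
  let ?Bad = "{R\<in>?Om. \<exists>as. set as \<subseteq> cube n \<and> length as = d \<and> colliding (2 ^ k) k n as R}"
  have finP: "finite P" using assms(1) by simp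
  have finOm: "finite ?Om" using finP by (auto intro: finite_PiE)
  have finXX: "finite ?XX" by (rule finite_subset[of _ "{..<n} \<rightarrow>\<^sub>E pair_sets (2 ^ k) k"]) (auto intro: finite_PiE)
  have finL: "finite ?L" by (rule finite_lists_length_eq) simp
  have "?Bad \<subseteq> (\<Union>as\<in>?L. \<Union>X\<in>?XX. S as X)"
  proof
    fix R assume "R \<in> ?Bad"
    then obtain as X where *: "R \<in> ?Om" "as \<in> ?L" "disjoint_family_on X {..<n}"
      "\<And>t. t < n \<Longrightarrow> X t \<in> pair_sets (2 ^ k) k" "\<And>t. t < n \<Longrightarrow> (\<Sum>p\<in>X t. R p) \<in> par_span as"
      unfolding colliding_def by blast
    have "restrict X {..<n} \<in> ?XX" using * by (auto simp: disjoint_family_on_def)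
    moreover have "R \<in> S as (restrict X {..<n})" using * by (auto simp: S_def)
    ultimately show "R \<in> (\<Union>as\<in>?L. \<Union>X\<in>?XX. S as X)" using *(2) by blast
  qed
  then have "card ?Bad \<le> card (\<Union>as\<in>?L. \<Union>X\<in>?XX. S as X)"
    by (intro card_mono finite_UN_I finL finXX) (auto simp: S_def intro: finite_subset[OF _ finOm])
  also have "\<dots> \<le> (\<Sum>as\<in>?L. card (\<Union>X\<in>?XX. S as X))" by (rule card_UN_le[OF finL])
  also have "\<dots> \<le> (\<Sum>as\<in>?L. \<Sum>X\<in>?XX. card (S as X))" by (intro sum_mono card_UN_le[OF finXX])
  finally have "card ?Bad * (2 ^ n) ^ n \<le> (\<Sum>as\<in>?L. \<Sum>X\<in>?XX. card (S as X)) * (2 ^ n) ^ n"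
    by (rule mult_right_mono) simp
  also have "\<dots> = (\<Sum>as\<in>?L. \<Sum>X\<in>?XX. card (S as X) * (2 ^ n) ^ n)"
    by (simp add: sum_distrib_right)
  also have "\<dots> \<le> (\<Sum>as\<in>?L. \<Sum>X\<in>?XX. card ?Om * (2 ^ d) ^ n)"
  proof (intro sum_mono)
    fix as X assume as: "as \<in> ?L" and X: "X \<in> ?XX"
    have X': "X t \<in> pair_sets (2 ^ k) k" if "t \<in> {..<n}" for t using X that by blast
    have "card (S as X) * (2 ^ n) ^ card {..<n} \<le> card ?Om * card (par_span as) ^ card {..<n}"
      unfolding S_def
    proof (rule card_forced_sums)
      show "X t \<subseteq> P" "X t \<noteq> {}" if "t \<in> {..<n}" for t
        using X'[OF that] assms(1) by (auto simp: pair_sets_iff)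
    qed (use X finP in auto)
    also have "\<dots> \<le> card ?Om * (2 ^ d) ^ card {..<n}"
      using card_par_span[of as] as by (intro mult_left_mono power_mono) auto
    finally show "card (S as X) * (2 ^ n) ^ n \<le> card ?Om * (2 ^ d) ^ n" by simp
  qed
  also have "\<dots> = card ?L * (card ?XX * (card ?Om * (2 ^ d) ^ n))" by simp
  also have "\<dots> \<le> (2 ^ n) ^ d * ((2 ^ (4 * k)) ^ n * (card ?Om * (2 ^ d) ^ n))"
  proof (intro mult_mono)
    show "card ?L \<le> (2 ^ n) ^ d" by (simp add: card_lists_length_eq card_cube)
    have "card ?XX \<le> card ({..<n} \<rightarrow>\<^sub>E pair_sets (2 ^ k) k)"
      by (intro card_mono) (auto intro: finite_PiE)
    also have "\<dots> = card (pair_sets (2 ^ k) k) ^ n" by (simp add: card_PiE)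
    also have "\<dots> \<le> (2 ^ (4 * k)) ^ n"
    proof (rule power_mono)
      have "card (pair_sets (2 ^ k) k) \<le> 2 ^ k * 2 ^ k * 2 ^ (2 * k)" by (rule card_pair_sets)
      also have "\<dots> = 2 ^ (k + k + 2 * k)" by (simp only: power_add)
      finally show "card (pair_sets (2 ^ k) k) \<le> 2 ^ (4 * k)" by simp
    qed simp
    finally show "card ?XX \<le> (2 ^ (4 * k)) ^ n" .
  qed auto
  also have "\<dots> = card ?Om * 2 ^ (n * d + 4 * k * n + d * n)"
    unfolding power_add power_mult[symmetric] by (simp only: mult_ac)
  finally have "card ?Bad * (2 ^ n) ^ n * 2 ^ n \<le> card ?Om * 2 ^ (n * d + 4 * k * n + d * n) * 2 ^ n"
    by (rule mult_right_mono) simp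
  also have "\<dots> = card ?Om * 2 ^ (n * d + 4 * k * n + d * n + n)" by (simp add: power_add)
  also have "\<dots> \<le> card ?Om * 2 ^ (n * n)"
  proof (intro mult_left_mono power_increasing)
    have "4 * (n * d) \<le> n * n" "8 * (k * n) + 2 * n \<le> n * n"
      using mult_le_mono2[OF assms(2), of n] mult_le_mono2[OF assms(3), of n] by (simp_all add: algebra_simps)
    moreover have "n * d + 4 * k * n + d * n + n = 2 * (n * d) + 4 * (k * n) + n" by simp
    ultimately show "n * d + 4 * k * n + d * n + n \<le> n * n" by linarith
  qed auto
  finally have "(card ?Bad * 2 ^ n) * 2 ^ (n * n) \<le> card ?Om * 2 ^ (n * n)"
    by (simp add: mult_ac flip: power_mult)
  then show ?thesis by simp
qed

text \<open>
  A maximal family of collisions on disjoint index pairs has fewer than \<open>s\<close> members, so deleting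
  the at most \<open>2 * s\<close> indices they use leaves no collision.
\<close>

lemma not_colliding_imp_independent:
  assumes "\<not> colliding M k s as R"
  shows "\<exists>I\<subseteq>{..<M}. M \<le> card I + 2 * s \<and>
    (\<forall>i\<in>I. \<forall>j\<in>I. \<forall>X. X \<subseteq> {i, j} \<times> {..<k} \<longrightarrow> X \<noteq> {} \<longrightarrow> (\<Sum>p\<in>X. R p) \<notin> par_span as)"
proof (rule ccontr)
  assume no: "\<not> ?thesis"
  have "\<exists>X J. J \<subseteq> {..<M} \<and> card J \<le> 2 * r \<and> disjoint_family_on X {..<r} \<and>
    (\<forall>t<r. X t \<in> pair_sets M k \<and> X t \<subseteq> J \<times> {..<k} \<and> (\<Sum>p\<in>X t. R p) \<in> par_span as)"
    if "r \<le> s" for r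
    using that
  proof (induction r)
    case 0
    then show ?case by (intro exI[of _ "\<lambda>_. {}"] exI[of _ "{}"]) (simp add: disjoint_family_on_def)
  next
    case (Suc r)
    then obtain X J where J: "J \<subseteq> {..<M}" "card J \<le> 2 * r" and disj: "disjoint_family_on X {..<r}"
      and X: "\<And>t. t < r \<Longrightarrow> X t \<in> pair_sets M k" "\<And>t. t < r \<Longrightarrow> X t \<subseteq> J \<times> {..<k}"
        "\<And>t. t < r \<Longrightarrow> (\<Sum>p\<in>X t. R p) \<in> par_span as"
      by auto
    have finJ: "finite J" using finite_subset[OF J(1)] by simp
    \<comment> \<open>Fewer than \<open>s\<close> collisions have been found, so \<open>J\<close> is
      small enough for \<open>no\<close> to apply to its complement; the collision found there is
      disjoint from all earlier ones.\<close>
    have "M \<le> card ({..<M} - J) + 2 * s"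
      using J Suc.prems finJ by (simp add: card_Diff_subset)
    then obtain i j Y where Y: "i \<in> {..<M} - J" "j \<in> {..<M} - J" "Y \<subseteq> {i, j} \<times> {..<k}" "Y \<noteq> {}"
      "(\<Sum>p\<in>Y. R p) \<in> par_span as"
      using no by (metis Diff_subset)
    define X' where "X' = X(r := Y)"
    have X': "X' r = Y" "\<And>t. t < r \<Longrightarrow> X' t = X t" by (auto simp: X'_def)
    have "disjoint_family_on X' {..<Suc r}"
    proof -
      have "Y \<inter> X t = {}" "X t \<inter> Y = {}" if "t < r" for t using Y X(2)[OF that] by blast+
      then show ?thesis using disj unfolding disjoint_family_on_def
        by (simp add: X' less_Suc_eq lessThan_Suc)
    qed
    moreover have "card (J \<union> {i, j}) \<le> 2 * Suc r"
      using card_Un_le[of J "{i, j}"] J(2) card_insert_le_m1[of 2 "{j}" i] by simp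
    moreover have "Y \<in> pair_sets M k" using Y by (auto simp: pair_sets_iff)
    moreover have "X t \<subseteq> (J \<union> {i, j}) \<times> {..<k}" if "t < r" for t using X(2)[OF that] by blast
    moreover have "Y \<subseteq> (J \<union> {i, j}) \<times> {..<k}" using Y(3) by blast
    ultimately show ?case
      using J Y X by (intro exI[of _ X'] exI[of _ "J \<union> {i, j}"]) (auto simp: X' less_Suc_eq)
  qed
  from this[of s] obtain X where "disjoint_family_on X {..<s}"
    "\<And>t. t < s \<Longrightarrow> X t \<in> pair_sets M k \<and> (\<Sum>p\<in>X t. R p) \<in> par_span as"
    by auto
  then show False using assms unfolding colliding_def by blast
qed

text \<open>A random row is orthogonal to a nonzero \<open>x\<close> with probability
  \<open>1/2\<close>, so one random subspace misses \<open>x\<close> with probability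
  \<open>1 - 1 / 2 ^ k\<close>, independently for the \<open>M\<close> subspaces. Uncurrying by
  \<open>\<Psi>\<close> embeds the missing choices, and injectivity suffices for a lower
  bound.\<close>

lemma card_missing:
  assumes x: "x \<in> cube n" "x \<noteq> 0" and P: "P = {..<M} \<times> {..<k}"
  shows "(1 - 1 / 2 ^ k) ^ M * card (P \<rightarrow>\<^sub>E cube n) \<le>
    real (card {R\<in>P \<rightarrow>\<^sub>E cube n. \<not> subspace_union n M k R x})"
proof -
  let ?H = "{r\<in>cube n. inner_F2 n r x = 0}"
  define G where "G = ({..<k} \<rightarrow>\<^sub>E cube n) - ({..<k} \<rightarrow>\<^sub>E ?H)"
  let ?S = "{R\<in>P \<rightarrow>\<^sub>E cube n. \<not> subspace_union n M k R x}"
  have H: "real (card ?H) = 2 ^ n / 2"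
    using card_leaf_Cons[of x n "[]" 0] x by (simp add: leaf_Cons inner_F2_commute[of n x] card_cube)
  have "real (card G) = real (card ({..<k} \<rightarrow>\<^sub>E cube n)) - real (card ({..<k} \<rightarrow>\<^sub>E ?H))"
    unfolding G_def
    by (subst card_Diff_subset) (auto intro!: finite_PiE PiE_mono card_mono of_nat_diff)
  also have "\<dots> = (2 ^ n) ^ k - (2 ^ n / 2) ^ k"
    by (simp add: card_PiE card_cube flip: H)
  also have "\<dots> = (1 - 1 / 2 ^ k) * (2 ^ n) ^ k"
    by (simp add: power_divide algebra_simps)
  finally have G: "real (card G) = (1 - 1 / 2 ^ k) * (2 ^ n) ^ k" .
  define \<Psi> where "\<Psi> = (\<lambda>r. restrict (\<lambda>p. r (fst p) (snd p) :: nat \<Rightarrow> bit) P)"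
  have "inj_on \<Psi> ({..<M} \<rightarrow>\<^sub>E G)"
  proof (rule inj_onI)
    fix r r' assume r: "r \<in> {..<M} \<rightarrow>\<^sub>E G" "r' \<in> {..<M} \<rightarrow>\<^sub>E G" "\<Psi> r = \<Psi> r'"
    have eq: "r i l = r' i l" if "i < M" "l < k" for i l
      using fun_cong[OF r(3), of "(i, l)"] that by (simp add: \<Psi>_def P)
    have mem: "r i \<in> {..<k} \<rightarrow>\<^sub>E cube n" "r' i \<in> {..<k} \<rightarrow>\<^sub>E cube n" if "i < M" for i
      using r(1,2) that by (auto simp: G_def PiE_def Pi_def)
    have "r i = r' i" if "i < M" for i
      using eq that by (intro PiE_ext[OF mem]) auto
    then show "r = r'" using r(1,2) by (intro PiE_ext[of r "{..<M}" "\<lambda>_. G"]) auto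
  qed
  moreover have "\<Psi> ` ({..<M} \<rightarrow>\<^sub>E G) \<subseteq> ?S"
  proof
    fix R assume "R \<in> \<Psi> ` ({..<M} \<rightarrow>\<^sub>E G)"
    then obtain r where r: "r \<in> {..<M} \<rightarrow>\<^sub>E G" "R = \<Psi> r" by blast
    have rG: "r i \<in> {..<k} \<rightarrow>\<^sub>E cube n" "r i \<notin> {..<k} \<rightarrow>\<^sub>E ?H" if "i < M" for i
      using PiE_mem[OF r(1), of i] that by (auto simp: G_def)
    have "\<exists>l<k. inner_F2 n (r i l) x \<noteq> 0" if i: "i < M" for i
    proof (rule ccontr)
      assume "\<not> ?thesis"
      then have "r i \<in> {..<k} \<rightarrow>\<^sub>E ?H" using rG(1)[OF i] by (auto simp: PiE_iff)
      then show False using rG(2)[OF i] by blast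
    qed
    then have "\<not> subspace_union n M k R x"
      unfolding subspace_union_def r(2) \<Psi>_def P by auto
    moreover have "R \<in> P \<rightarrow>\<^sub>E cube n"
      unfolding r(2) \<Psi>_def using PiE_mem[OF rG(1)] by (auto simp: P)
    ultimately show "R \<in> ?S" by blast
  qed
  moreover have "finite ?S" by (rule finite_subset[of _ "P \<rightarrow>\<^sub>E cube n"]) (auto simp: P intro: finite_PiE)
  ultimately have "card ({..<M} \<rightarrow>\<^sub>E G) \<le> card ?S" by (rule card_inj_on_le)
  then have "real (card G) ^ M \<le> real (card ?S)"
    by (simp add: card_PiE flip: of_nat_power)
  moreover have "real (card G) ^ M = (1 - 1 / 2 ^ k) ^ M * card (P \<rightarrow>\<^sub>E cube n)"
    unfolding G P by (simp add: card_PiE card_cube power_mult_distrib card_cartesian_product mult.commute[of M] power_mult)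
  ultimately show ?thesis by simp
qed

text \<open>The sequence increases to \<open>1/e\<close> as \<open>k\<close> grows; at
  \<open>k = 6\<close> it is already about \<open>0.365\<close>.\<close>

lemma one_minus_inverse_power_ge:
  assumes "6 \<le> k"
  shows "9 / 25 \<le> (1 - 1 / 2 ^ k :: real) ^ 2 ^ k"
  using assms
proof (induction k rule: dec_induct)
  case base
  have "(9 / 25 :: real) \<le> ((((((63 / 64)\<^sup>2)\<^sup>2)\<^sup>2)\<^sup>2)\<^sup>2)\<^sup>2"
    by (simp add: power_divide)
  then show ?case by (simp flip: power_mult)
next
  case (step k)
  have "1 - 1 / 2 ^ k \<le> (1 - 1 / 2 ^ Suc k :: real)\<^sup>2"
    by (simp add: power2_eq_square field_simps)
  then have "(1 - 1 / 2 ^ k :: real) ^ 2 ^ k \<le> ((1 - 1 / 2 ^ Suc k)\<^sup>2) ^ 2 ^ k"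
    by (rule power_mono) simp
  then show ?case using step.IH by (simp flip: power_mult)
qed

text \<open>Averaging the number of missed points over all choices of rows: the mean is at least
  \<open>9/25 * (2 ^ n - 1)\<close>. If no choice were good, the colliding ones, a fraction at most
  \<open>1 / 2 ^ n\<close>, would add at most \<open>1\<close> to a mean otherwise below
  \<open>7/20 * 2 ^ n\<close>.\<close>

lemma ex_good_rows:
  assumes "4 * d \<le> n" "8 * k + 2 \<le> n" "6 \<le> k"
  shows "\<exists>R. (\<forall>i<2 ^ k. \<forall>l<k. R (i, l) \<in> cube n) \<and>
    (\<forall>as. set as \<subseteq> cube n \<and> length as = d \<longrightarrow> \<not> colliding (2 ^ k) k n as R) \<and>
    7 / 20 * 2 ^ n \<le> real (card {x\<in>cube n. \<not> subspace_union n (2 ^ k) k R x})"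
proof (rule ccontr)
  assume no: "\<not> ?thesis"
  define P :: "(nat \<times> nat) set" where "P = {..<2 ^ k} \<times> {..<k}"
  let ?Om = "P \<rightarrow>\<^sub>E cube n"
  let ?f = "subspace_union n (2 ^ k) k"
  define c where "c = (\<lambda>R. real (card {x\<in>cube n. \<not> ?f R x}))"
  define Bad where "Bad = {R\<in>?Om. \<exists>as. set as \<subseteq> cube n \<and> length as = d \<and> colliding (2 ^ k) k n as R}"
  have finOm: "finite ?Om" unfolding P_def by (intro finite_PiE) auto
  have "cube n \<noteq> {}" using zero_in_cube[of n] by blast
  then have "?Om \<noteq> {}" by (simp add: PiE_eq_empty_iff)
  then have Om0: "0 < real (card ?Om)" using finOm by (simp add: card_gt_0_iff)
  have "card Bad * 2 ^ n \<le> card ?Om"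
    unfolding Bad_def using card_colliding[OF P_def assms(1,2)] .
  then have bad: "real (card Bad) * 2 ^ n \<le> card ?Om"
    by (metis of_nat_le_iff of_nat_mult of_nat_numeral of_nat_power)
  have c_le: "c R \<le> (if R \<in> Bad then 2 ^ n else 0) + 7 / 20 * 2 ^ n" if "R \<in> ?Om" for R
  proof (cases "R \<in> Bad")
    case True
    have "card {x\<in>cube n. \<not> ?f R x} \<le> card (cube n)" by (intro card_mono) auto
    then have "c R \<le> real (card (cube n))" unfolding c_def by (rule of_nat_mono)
    then have "c R \<le> 2 ^ n" by (simp add: card_cube)
    moreover have "(0::real) \<le> 7 / 20 * 2 ^ n" by simp
    ultimately show ?thesis unfolding if_P[OF True] by linarith
  next
    case False
    have "R (i, l) \<in> cube n" if "i < 2 ^ k" "l < k" for i l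
      using PiE_mem[OF \<open>R \<in> ?Om\<close>, of "(i, l)"] that by (simp add: P_def)
    then have "\<not> 7 / 20 * 2 ^ n \<le> c R" using no False that unfolding Bad_def c_def by blast
    then show ?thesis using False by simp
  qed
  \<comment> \<open>The origin is left out because it lies in every subspace.\<close>
  have "(2 ^ n - 1) * (9 / 25 * card ?Om) = (\<Sum>x\<in>cube n - {0}. 9 / 25 * real (card ?Om))"
    by (simp add: card_Diff_subset card_cube of_nat_diff)
  also have "\<dots> \<le> (\<Sum>x\<in>cube n - {0}. real (card {R\<in>?Om. \<not> ?f R x}))"
  proof (rule sum_mono)
    fix x assume "x \<in> cube n - {0}"
    then have "(1 - 1 / 2 ^ k) ^ 2 ^ k * card ?Om \<le> real (card {R\<in>?Om. \<not> ?f R x})"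
      using card_missing[OF _ _ P_def] by simp
    moreover have "9 / 25 * real (card ?Om) \<le> (1 - 1 / 2 ^ k) ^ 2 ^ k * card ?Om"
      using one_minus_inverse_power_ge[OF assms(3)] by (rule mult_right_mono) simp
    ultimately show "9 / 25 * real (card ?Om) \<le> real (card {R\<in>?Om. \<not> ?f R x})" by linarith
  qed
  also have "\<dots> \<le> (\<Sum>x\<in>cube n. real (card {R\<in>?Om. \<not> ?f R x}))"
    by (intro sum_mono2) auto
  also have "\<dots> = (\<Sum>x\<in>cube n. \<Sum>R\<in>?Om. of_bool (\<not> ?f R x))"
    using finOm by (simp add: of_bool_def sum.If_cases Int_def)
  also have "\<dots> = (\<Sum>R\<in>?Om. c R)"
    by (subst sum.swap) (simp add: c_def of_bool_def sum.If_cases Int_def)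
  also have "\<dots> \<le> (\<Sum>R\<in>?Om. (if R \<in> Bad then 2 ^ n else 0) + 7 / 20 * 2 ^ n)"
    using c_le by (rule sum_mono)
  also have "\<dots> = card Bad * 2 ^ n + card ?Om * (7 / 20 * 2 ^ n)"
  proof -
    have "?Om \<inter> Bad = Bad" by (auto simp: Bad_def)
    then show ?thesis using finOm by (simp add: sum.distrib sum.If_cases)
  qed
  also have "\<dots> \<le> card ?Om * (1 + 7 / 20 * 2 ^ n)" using bad by (simp add: algebra_simps)
  finally have "card ?Om * ((2 ^ n - 1) * (9 / 25)) \<le> card ?Om * (1 + 7 / 20 * 2 ^ n)"
    by (simp only: mult_ac)
  then have "(2 ^ n - 1) * (9 / 25) \<le> (1 + 7 / 20 * 2 ^ n :: real)"
    using Om0 by (simp only: mult_le_cancel_left_pos)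
  \<comment> \<open>The previous inequality would force \<open>2 ^ n\<close> to be at most
    \<open>136\<close>.\<close>
  moreover have "(2::real) ^ 8 \<le> 2 ^ n" using assms by (intro power_increasing) auto
  ultimately show False by simp
qed

subsection \<open>The uniform distribution\<close>

lemma uniform_product_dist:
  obtains \<mu> where "\<mu> \<in> product_dists n" "\<And>x. x \<in> cube n \<Longrightarrow> pmf \<mu> x = 1 / 2 ^ n"
proof
  let ?q = "map_pmf of_bool (bernoulli_pmf (1/2)) :: bit pmf"
  show "Pi_pmf {..<n} 0 (\<lambda>i. map_pmf of_bool (bernoulli_pmf ((\<lambda>_. 1/2) i))) \<in> product_dists n"
    unfolding product_dists_def by (rule CollectI, rule exI[of _ "\<lambda>_. 1/2"]) simp
  have q: "pmf ?q b = 1 / 2" for b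
  proof -
    have "inj (of_bool :: bool \<Rightarrow> bit)" by (auto intro: injI)
    moreover obtain c where "b = of_bool c" using bit_cases[of b] by (metis of_bool_eq(1,2))
    ultimately show ?thesis by (simp add: pmf_map_inj')
  qed
  show "pmf (Pi_pmf {..<n} 0 (\<lambda>i. map_pmf of_bool (bernoulli_pmf ((\<lambda>_. 1/2) i)))) x = 1 / 2 ^ n"
    if "x \<in> cube n" for x
  proof -
    have "pmf (Pi_pmf {..<n} 0 (\<lambda>_. ?q)) x = (\<Prod>i<n. pmf ?q (x i))"
      using that by (intro pmf_Pi') (auto simp: cube_def)
    then show ?thesis by (simp add: q power_divide)
  qed
qed

lemma D_prod_subspace_union:
  assumes R: "\<forall>i<2 ^ k. \<forall>l<k. R (i, l) \<in> cube n"
    and ncoll: "\<forall>as. set as \<subseteq> cube n \<and> length as = d \<longrightarrow> \<not> colliding (2 ^ k) k n as R"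
    and few: "7 / 20 * 2 ^ n \<le> real (card {x\<in>cube n. \<not> subspace_union n (2 ^ k) k R x})"
    and k: "16 * n \<le> 2 ^ k"
  shows "d < D_prod n (subspace_union n (2 ^ k) k R)"
proof -
  let ?f = "subspace_union n (2 ^ k) k R"
  obtain \<mu> where \<mu>: "\<mu> \<in> product_dists n" "\<And>x. x \<in> cube n \<Longrightarrow> pmf \<mu> x = 1 / 2 ^ n"
    using uniform_product_dist by blast
  have \<mu>': "\<mu> \<in> dists n" using \<mu>(1) product_dists_subset by blast
  have dense: "(1/2 - 1/128) * card (leaf n q) \<le> real (card {x\<in>leaf n q. ?f x})"
    if q: "length q \<le> d" "fst ` set q \<subseteq> cube n" for q
  proof -
    \<comment> \<open>\<open>ncoll\<close> speaks of lists of length exactly \<open>d\<close>, hence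
      the padding by zero queries.\<close>
    let ?as = "replicate (d - length q) 0 @ map fst q"
    have "\<not> colliding (2 ^ k) k n ?as R" 
    proof -
      have "set ?as \<subseteq> cube n" "length ?as = d" using q by (auto simp: image_subset_iff)
      then show ?thesis using ncoll by blast
    qed
    from not_colliding_imp_independent[OF this, unfolded par_span_replicate_0]
    obtain I where I: "I \<subseteq> {..<2 ^ k}" "2 ^ k \<le> card I + 2 * n"
      and indep: "\<forall>i\<in>I. \<forall>j\<in>I. \<forall>X. X \<subseteq> {i, j} \<times> {..<k} \<longrightarrow> X \<noteq> {} \<longrightarrow>
        (\<Sum>p\<in>X. R p) \<notin> par_span (map fst q)"
      by (elim exE conjE)
    show ?thesis
    proof (rule leaf_density)
      \<comment> \<open>The \<open>2 * n\<close> deleted indices are at most an eighth of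
        \<open>2 ^ k\<close>.\<close>
      show "7 * 2 ^ k \<le> 8 * card I" using I(2) k by simp
    next
      show "(\<Sum>p\<in>X. R p) \<notin> par_span (map fst q)"
        if "i \<in> I" "j \<in> I" "X \<subseteq> {i, j} \<times> {..<k}" "X \<noteq> {}" for i j X
        using indep that by simp
    qed (use R q I in simp_all)
  qed
  have "d < D_err (1/3) n ?f \<mu>"
  proof (rule less_D_err[OF \<mu>'])
    fix T assume T: "pdt_on n T" "pdt_depth T \<le> d"
    \<comment> \<open>The margin is narrow: \<open>7/20 - 1/64 = 107/320\<close>, just above
      \<open>1/3\<close>.\<close>
    have "7 / 20 * 2 ^ n - 2 ^ n / 64 \<le> real (card {x\<in>cube n. pdt_eval n T x \<noteq> ?f x})"
      using pdt_error_ge[of d n ?f T "[]"] dense T few by (simp add: card_cube)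
    then have err: "1 / 3 * 2 ^ n < real (card {x\<in>cube n. pdt_eval n T x \<noteq> ?f x})"
      using zero_less_power[of "2::real" n] by linarith
    have "1 / 3 < real (card {x\<in>cube n. pdt_eval n T x \<noteq> ?f x}) / 2 ^ n"
      using err by (subst pos_less_divide_eq) auto
    also have "\<dots> = (\<Sum>x\<in>{x. pdt_eval n T x \<noteq> ?f x} \<inter> cube n. 1 / 2 ^ n)"
      by (simp add: Int_def conj_commute)
    also have "\<dots> = measure_pmf.prob \<mu> {x. pdt_eval n T x \<noteq> ?f x}"
      unfolding prob_eq_sum_cube[OF \<mu>'] using \<mu>(2) by (intro sum.cong) auto
    finally show "1 / 3 < measure_pmf.prob \<mu> {x. pdt_eval n T x \<noteq> ?f x}" .
  qed
  also have "\<dots> \<le> D_prod n ?f" by (rule D_err_le_D_prod[OF \<mu>(1)])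
  finally show ?thesis .
qed

theorem lemma3:
  shows "(\<exists>f :: nat \<Rightarrow> (nat \<Rightarrow> bit) \<Rightarrow> bool.
            (\<lambda>n. disc n (f n)) \<in> O(\<lambda>n. log 2 (real n)) \<and>
            (\<lambda>n. real (D_prod n (f n))) \<in> \<Theta>(\<lambda>n. real n)) \<and>
         (\<exists>f :: nat \<Rightarrow> (nat \<Rightarrow> bit) \<Rightarrow> bool.
            (\<lambda>n. disc n (f n)) \<in> \<Theta>(\<lambda>n. real n) \<and>
            (\<lambda>n. real (D_prod n (f n))) \<in> O(\<lambda>n. 1))"
proof
  \<comment> \<open>The summand \<open>4\<close> yields \<open>16 * n \<le> 2 ^ k n\<close>, while
    rounding keeps \<open>k n\<close> within \<open>log 2 n + 5\<close>, so the number of subspaces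
    stays linear in \<open>n\<close>.\<close>
  define k where "k = (\<lambda>n::nat. nat \<lceil>log 2 n\<rceil> + 4)"
  have k_upper: "real (k n) \<le> log 2 n + 5" and k_lower: "16 * n \<le> 2 ^ k n" if "1 \<le> n" for n
  proof -
    have pos: "0 \<le> log 2 (real n)" using that by simp
    then show "real (k n) \<le> log 2 n + 5" unfolding k_def by linarith
    have "real n = 2 powr log 2 n" using that by simp
    also have "\<dots> \<le> 2 powr real (nat \<lceil>log 2 n\<rceil>)" by (intro powr_mono) linarith+
    also have "\<dots> = real (2 ^ nat \<lceil>log 2 n\<rceil>)" by (simp add: powr_realpow)
    finally have "n \<le> 2 ^ nat \<lceil>log 2 n\<rceil>" by (simp only: of_nat_le_iff)
    then show "16 * n \<le> 2 ^ k n" by (simp add: k_def power_add)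
  qed
  have ev: "\<forall>\<^sub>F n in at_top. 8 * (log 2 (real n) + 5) + 2 \<le> real n" by real_asymp
  have "\<exists>f. disc n f \<le> log 2 n + 7 \<and> n div 4 < D_prod n f"
    if n: "4 \<le> n" "8 * (log 2 (real n) + 5) + 2 \<le> real n" for n
  proof -
    have "2 \<le> log 2 (real n)" using n(1) by (simp add: le_log_iff)
    then have "6 \<le> k n" unfolding k_def by linarith
    moreover have "8 * k n + 2 \<le> n"
    proof -
      have "real (k n) \<le> log 2 n + 5" using k_upper[of n] n(1) by simp
      then have "real (8 * k n + 2) \<le> real n" using n(2) by simp
      then show ?thesis by (simp only: of_nat_le_iff)
    qed
    ultimately obtain R where "\<forall>i<2 ^ k n. \<forall>l<k n. R (i, l) \<in> cube n"
      "\<forall>as. set as \<subseteq> cube n \<and> length as = n div 4 \<longrightarrow> \<not> colliding (2 ^ k n) (k n) n as R"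
      "7 / 20 * 2 ^ n \<le> real (card {x\<in>cube n. \<not> subspace_union n (2 ^ k n) (k n) R x})"
      using ex_good_rows[of "n div 4" n "k n"] by auto
    then have "n div 4 < D_prod n (subspace_union n (2 ^ k n) (k n) R)"
      using k_lower[of n] n(1) by (intro D_prod_subspace_union) auto
    moreover have "disc n (subspace_union n (2 ^ k n) (k n) R) \<le> log 2 n + 7"
    proof -
      have "disc n (subspace_union n (2 ^ k n) (k n) R) \<le> log 2 (2 * real (2 ^ k n) + 1)"
        by (rule disc_subspace_union)
      also have "\<dots> \<le> log 2 (2 ^ (k n + 2))"
      proof -
        have "(1::real) \<le> 2 ^ k n" by (rule one_le_power) simp
        then have "2 * real (2 ^ k n) + 1 \<le> 4 * 2 ^ k n" unfolding of_nat_power of_nat_numeral by linarith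
        then show ?thesis by (subst log_le_cancel_iff) (auto simp: add_pos_pos)
      qed
      also have "\<dots> = real (k n) + 2" by (simp only: log_pow_cancel)
      also have "\<dots> \<le> log 2 n + 7" using k_upper[of n] n(1) by simp
      finally show ?thesis .
    qed
    ultimately show ?thesis by blast
  qed
  \<comment> \<open>For the finitely many \<open>n\<close> violating the premises,
    \<open>f n\<close> is arbitrary.\<close>
  then obtain f where f: "\<And>n. 4 \<le> n \<Longrightarrow> 8 * (log 2 (real n) + 5) + 2 \<le> real n \<Longrightarrow>
      disc n (f n) \<le> log 2 n + 7 \<and> n div 4 < D_prod n (f n)"
    by metis
  have "(\<lambda>n. disc n (f n)) \<in> O(\<lambda>n. log 2 n + 7)"
    using eventually_conj[OF eventually_ge_at_top[of 4] ev]
    by (intro bigoI[of _ 1], elim eventually_mono) (use f disc_nonneg in force)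
  also have "(\<lambda>n. log 2 (real n) + 7) \<in> O(\<lambda>n. log 2 (real n))" by real_asymp
  finally have "(\<lambda>n. disc n (f n)) \<in> O(\<lambda>n. log 2 (real n))" .
  moreover have "(\<lambda>n. real (D_prod n (f n))) \<in> \<Theta>(\<lambda>n. real n)"
  proof (rule bigthetaI)
    show "(\<lambda>n. real (D_prod n (f n))) \<in> O(\<lambda>n. real n)"
      by (intro bigoI[of _ 1]) (simp add: D_prod_le_n)
    show "(\<lambda>n. real (D_prod n (f n))) \<in> \<Omega>(\<lambda>n. real n)"
    proof (rule landau_omega.bigI[of "1 / 4"])
      show "\<forall>\<^sub>F n in at_top. 1 / 4 * norm (real n) \<le> norm (real (D_prod n (f n)))"
        using eventually_conj[OF eventually_ge_at_top[of 4] ev]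
      proof eventually_elim
        case (elim n)
        then have "n div 4 < D_prod n (f n)" using f by blast
        then show ?case by simp
      qed
    qed simp
  qed
  ultimately show "\<exists>f :: nat \<Rightarrow> (nat \<Rightarrow> bit) \<Rightarrow> bool.
      (\<lambda>n. disc n (f n)) \<in> O(\<lambda>n. log 2 (real n)) \<and>
      (\<lambda>n. real (D_prod n (f n))) \<in> \<Theta>(\<lambda>n. real n)"
    by blast
next
  \<comment> \<open>Each unit of \<open>h\<close> takes two message bits, each repeated three times;
    leftover coordinates are padding.\<close>
  define f where "f = (\<lambda>n. ip_code (n div 6))"
  have "(\<lambda>n. disc n (f n)) \<in> \<Theta>(\<lambda>n. real n)"
  proof (rule bigthetaI)
    show "(\<lambda>n. disc n (f n)) \<in> O(\<lambda>n. real n)"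
      by (intro bigoI[of _ 1]) (simp add: disc_le_n disc_nonneg)
    show "(\<lambda>n. disc n (f n)) \<in> \<Omega>(\<lambda>n. real n)"
    proof (rule landau_omega.bigI[of "1 / 12"])
      show "\<forall>\<^sub>F n in at_top. 1 / 12 * norm (real n) \<le> norm (disc n (f n))"
        using eventually_ge_at_top[of 6]
      proof eventually_elim
        case (elim n)
        have "real (n div 6) \<le> disc n (f n)" unfolding f_def by (rule disc_ip_code) simp
        \<comment> \<open>For \<open>n\<close> at least \<open>6\<close> the quotient is positive
          and absorbs the remainder, which is at most \<open>5\<close>.\<close>
        moreover have "n \<le> 12 * (n div 6)" using elim by presburger
        then have "real n \<le> 12 * real (n div 6)" by (metis of_nat_le_iff of_nat_mult of_nat_numeral)
        ultimately show ?case by simp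
      qed
    qed simp
  qed
  moreover have "(\<lambda>n. real (D_prod n (f n))) \<in> O(\<lambda>n. 1)"
  proof (rule bigoI[of _ 3])
    have "D_prod n (f n) \<le> 3" for n unfolding f_def by (rule D_prod_ip_code) simp
    then show "\<forall>\<^sub>F n in at_top. norm (real (D_prod n (f n))) \<le> 3 * norm (1::real)" by simp
  qed
  ultimately show "\<exists>f :: nat \<Rightarrow> (nat \<Rightarrow> bit) \<Rightarrow> bool.
      (\<lambda>n. disc n (f n)) \<in> \<Theta>(\<lambda>n. real n) \<and> (\<lambda>n. real (D_prod n (f n))) \<in> O(\<lambda>n. 1)"
    by blast
qed

end
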